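(* Let $n\ge 2$, let $A\in GL(n,\mathbb{R})$, $v\in\mathbb{R}^n$, and let $f_{A,v}:\mathbb{R}^n\to\mathbb{R}^n$, $f_{A,v}(x)=Ax+v$. Then there exists a complete Riemannian metric on $\mathbb{R}^n$ with respect to which $f_{A,v}$ is Anosov if and only if at least one of the following holds: 1. $A$ is hyperbolic, i.e. $\operatorname{Spec}(A)\cap\mathbb{S}^1=\varnothing$; or 2. $f_{A,v}$ has no fixed point, equivalently $v\notin\operatorname{Im}(I-A)$.
   Context: $\mathbb{S}^1=\{z\in\mathbb{C}:|z|=1\}$ and $\operatorname{Spec}(A)\subset\mathbb{C}$ is the set of complex eigenvalues of $A$. A diffeomorphism $f:M\to M$ of a smooth manifold is Anosov with respect to a Riemannian metric $\rho$ if there are a continuous $Df$-invariant splitting $TM=E^s\oplus E^u$ and constants $C\ge 1$, $\lambda\in(0,1)$ such that for all integers $m\ge 0$: $\|Df^m(w)\|_\rho\le C\lambda^m\|w\|_\rho$ for all $w\in E^s$, and $\|Df^{-m}(w)\|_\rho\le C\lambda^m\|w\|_\rho$ for all $w\in E^u$. The splitting may be trivial ($E^s=\{0\}$ or $E^u=\{0\}$ is allowed). *)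

theory Defs
  imports "HOL-Analysis.Analysis"
begin

text \<open>
  Euclidean space is treated as a manifold with its global chart: every tangent space is identified
  with the ambient vector space, and a tangent vector at \<open>x\<close> is a pair of \<open>x\<close> and a vector \<open>w\<close>.
\<close>

primrec times_continuously_differentiable ::
  "nat \<Rightarrow> ('a::real_normed_vector \<Rightarrow> 'b::real_normed_vector) \<Rightarrow> bool" where
  "times_continuously_differentiable 0 f \<longleftrightarrow> continuous_on UNIV f"
| "times_continuously_differentiable (Suc k) f \<longleftrightarrow>
     (\<forall>x. f differentiable (at x)) \<and>
     (\<forall>v. times_continuously_differentiable k (\<lambda>x. frechet_derivative f (at x) v))"

definition smooth :: "('a::euclidean_space \<Rightarrow> 'b::euclidean_space) \<Rightarrow> bool" where
  "smooth f \<longleftrightarrow> (\<forall>k. times_continuously_differentiable k f)"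

definition diffeomorphism :: "('a::euclidean_space \<Rightarrow> 'a) \<Rightarrow> bool" where
  "diffeomorphism f \<longleftrightarrow> bij f \<and> smooth f \<and> smooth (inv f)"

text \<open>Here \<open>g x u w\<close> is the inner product at the point \<open>x\<close> of the tangent vectors \<open>u\<close> and \<open>w\<close>.\<close>

definition riemannian_metric :: "('a::euclidean_space \<Rightarrow> 'a \<Rightarrow> 'a \<Rightarrow> real) \<Rightarrow> bool" where
  "riemannian_metric g \<longleftrightarrow>
     (\<forall>x. bilinear (g x)) \<and>
     (\<forall>x u w. g x u w = g x w u) \<and>
     (\<forall>x u. u \<noteq> 0 \<longrightarrow> g x u u > 0) \<and>
     (\<forall>u w. smooth (\<lambda>x. g x u w))"

definition riemannian_norm :: "('a::euclidean_space \<Rightarrow> 'a \<Rightarrow> 'a \<Rightarrow> real) \<Rightarrow> 'a \<Rightarrow> 'a \<Rightarrow> real" where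
  "riemannian_norm g x w = sqrt (g x w w)"

text \<open>
  The infimum of the lengths of the piecewise continuously differentiable curves from \<open>x\<close> to \<open>y\<close>.
  A \<open>valid_path\<close> may have unbounded speed near a break point, and so may have infinite length;
  stating the length by \<open>has_integral\<close> (rather than by \<open>integral\<close>, which would give such a curve the
  length 0) leaves these curves out of the infimum.
\<close>

definition riemannian_dist :: "('a::euclidean_space \<Rightarrow> 'a \<Rightarrow> 'a \<Rightarrow> real) \<Rightarrow> 'a \<Rightarrow> 'a \<Rightarrow> real" where
  "riemannian_dist g x y =
     Inf {L. \<exists>c. valid_path c \<and> pathstart c = x \<and> pathfinish c = y \<and>
             ((\<lambda>t. riemannian_norm g (c t) (vector_derivative c (at t))) has_integral L) {0..1}}"

definition complete_riemannian_metric :: "('a::euclidean_space \<Rightarrow> 'a \<Rightarrow> 'a \<Rightarrow> real) \<Rightarrow> bool" where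
  "complete_riemannian_metric g \<longleftrightarrow>
     riemannian_metric g \<and>
     (\<forall>p :: nat \<Rightarrow> 'a.
        (\<forall>e>0. \<exists>N. \<forall>m\<ge>N. \<forall>k\<ge>N. riemannian_dist g (p m) (p k) < e) \<longrightarrow>
        (\<exists>q. (\<lambda>m. riemannian_dist g (p m) q) \<longlonglongrightarrow> 0))"

text \<open>A field \<open>E\<close> of subspaces that has a continuous frame in a neighbourhood of every point.\<close>

definition continuous_subbundle :: "('a::euclidean_space \<Rightarrow> 'a set) \<Rightarrow> bool" where
  "continuous_subbundle E \<longleftrightarrow>
     (\<forall>x. \<exists>U (r::nat) X. open U \<and> x \<in> U \<and>
        (\<forall>i<r. continuous_on U (X i)) \<and>
        (\<forall>y\<in>U. inj_on (\<lambda>i. X i y) {..<r} \<and>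
                independent ((\<lambda>i. X i y) ` {..<r}) \<and>
                span ((\<lambda>i. X i y) ` {..<r}) = E y))"

definition continuous_splitting ::
  "('a::euclidean_space \<Rightarrow> 'a set) \<Rightarrow> ('a \<Rightarrow> 'a set) \<Rightarrow> bool" where
  "continuous_splitting Es Eu \<longleftrightarrow>
     continuous_subbundle Es \<and> continuous_subbundle Eu \<and>
     (\<forall>x. Es x \<inter> Eu x = {0} \<and> {a + b | a b. a \<in> Es x \<and> b \<in> Eu x} = UNIV)"

definition derivative_invariant ::
  "('a::euclidean_space \<Rightarrow> 'a) \<Rightarrow> ('a \<Rightarrow> 'a set) \<Rightarrow> bool" where
  "derivative_invariant f E \<longleftrightarrow> (\<forall>x. frechet_derivative f (at x) ` E x = E (f x))"

definition anosov ::
  "('a::euclidean_space \<Rightarrow> 'a \<Rightarrow> 'a \<Rightarrow> real) \<Rightarrow> ('a \<Rightarrow> 'a) \<Rightarrow> bool" where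
  "anosov g f \<longleftrightarrow>
     diffeomorphism f \<and>
     (\<exists>Es Eu (C::real) (l::real).
        continuous_splitting Es Eu \<and>
        derivative_invariant f Es \<and> derivative_invariant f Eu \<and>
        1 \<le> C \<and> 0 < l \<and> l < 1 \<and>
        (\<forall>m x. \<forall>w\<in>Es x.
           riemannian_norm g ((f ^^ m) x) (frechet_derivative (f ^^ m) (at x) w)
             \<le> C * l ^ m * riemannian_norm g x w) \<and>
        (\<forall>m x. \<forall>w\<in>Eu x.
           riemannian_norm g ((inv f ^^ m) x) (frechet_derivative (inv f ^^ m) (at x) w)
             \<le> C * l ^ m * riemannian_norm g x w))"

definition affine_map :: "real ^ 'n ^ 'n \<Rightarrow> real ^ 'n \<Rightarrow> real ^ 'n \<Rightarrow> real ^ 'n" where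
  "affine_map A v x = A *v x + v"

definition Spec :: "real ^ 'n ^ 'n \<Rightarrow> complex set" where
  "Spec A = {z. \<exists>w :: complex ^ 'n. w \<noteq> 0 \<and> map_matrix complex_of_real A *v w = z *s w}"

definition hyperbolic_matrix :: "real ^ 'n ^ 'n \<Rightarrow> bool" where
  "hyperbolic_matrix A \<longleftrightarrow> Spec A \<inter> sphere 0 1 = {}"

end

theory Submission
  imports Defs "HOL-Computational_Algebra.Fundamental_Theorem_Algebra"
begin

text \<open>
  At a fixed point \<open>p\<close> the derivative is \<open>A\<close>, and a complex eigenvector of modulus one spans a real
  plane with bounded orbits in both time directions; its stable and unstable components must vanish.
  Conversely, a hyperbolic \<open>A\<close> is Anosov for the Euclidean metric.

  Without a fixed point there is \<open>a\<close> with \<open>A\<^sup>T a = a\<close> and \<open>a \<bullet> v = 1\<close>, so that the time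
  \<open>t = a \<bullet> x\<close> advances by one under the map. Take \<open>E\<^sup>s = ker a\<close> and \<open>E\<^sup>u\<close> spanned by an
  invariant vector field \<open>X\<close> with \<open>a \<bullet> X = 1\<close>, and scale the Euclidean norm by
  \<open>exp (- c t)\<close> on \<open>E\<^sup>s\<close> and by \<open>exp (c t)\<close> on \<open>E\<^sup>u\<close>: for large \<open>c\<close> this beats the growth of
  \<open>A\<close> and of its inverse. The only obstruction to completeness is a path of finite length that runs
  to \<open>t = - \<infinity>\<close> nearly along \<open>X\<close>. It is removed by letting every integral curve of \<open>X\<close> blow up within
  half a unit of time, in a direction of \<open>ker a\<close>; here the dimension must be at least two.
\<close>

section \<open>Calculus of continuously differentiable maps\<close>

text \<open>The weight \<open>exp (c t)\<close> makes advancing in time expensive as t grows, but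
  cheap as t tends to minus infinity: there an integral curve of moderate speed would have finite
  length. On the other hand, for very negative t the stable weight \<open>exp (- c t)\<close> forces
  a short path to follow \<open>X\<close> almost exactly. So it suffices that each unit of time
  contains half a unit in which s' = 8 (1 + s^2) along \<open>X\<close>. There t - arctan s / 8 is
  constant along \<open>X\<close>; since the arctangent varies by less than pi and pi / 8 < 1/2, no
  short path gets across. The factor 8 thus only has to exceed 2 pi. The other half unit is left for
  a smooth transition between consecutive fields, which makes invariance and smoothness compatible.
  In the hyperbolic case the splitting is built from rates of decay, not from generalised
  eigenspaces: each vector of the complexification is annihilated by a polynomial in the map, whose
  linear factors are removed one at a time.\<close>

abbreviation tcd ::
  "nat \<Rightarrow> ('a::real_normed_vector \<Rightarrow> 'b::real_normed_vector) \<Rightarrow> bool" where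
  "tcd \<equiv> times_continuously_differentiable"

lemma tcd_SucI:
  assumes "\<And>x. (f has_derivative f' x) (at x)" "\<And>v. tcd k (\<lambda>x. f' x v)"
  shows "tcd (Suc k) f"
proof -
  have "frechet_derivative f (at x) = f' x" for x
    using frechet_derivative_at[OF assms(1)] by simp
  with assms show ?thesis by (auto simp: differentiable_def)
qed

lemma tcd_Suc_has_derivative:
  "tcd (Suc k) f \<Longrightarrow> (f has_derivative frechet_derivative f (at x)) (at x)"
  using frechet_derivative_works by auto

lemma tcd_Suc_frechet: "tcd (Suc k) f \<Longrightarrow> tcd k (\<lambda>x. frechet_derivative f (at x) v)"
  by auto

lemma tcd_continuous_on: "tcd k f \<Longrightarrow> continuous_on UNIV f"
  by (cases k) (auto intro!: continuous_at_imp_continuous_on differentiable_imp_continuous_within)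

lemma tcd_Suc_imp_tcd: "tcd (Suc k) f \<Longrightarrow> tcd k f"
proof (induction k arbitrary: f)
  case 0
  then show ?case using tcd_continuous_on[of "Suc 0" f] by simp
next
  case (Suc k)
  then have "tcd k (\<lambda>x. frechet_derivative f (at x) v)" for v
    using tcd_Suc_frechet by blast
  moreover have "\<forall>x. f differentiable (at x)"
    using Suc.prems by simp
  ultimately show ?case by simp
qed

lemma tcd_const: "tcd k (\<lambda>x. c)"
proof (induction k arbitrary: c)
  case (Suc k)
  show ?case by (rule tcd_SucI[where f' = "\<lambda>_ _. 0"]) (auto intro: Suc.IH)
qed simp

lemma tcd_bounded_linear:
  assumes "bounded_linear L"
  shows "tcd k L"
proof (cases k)
  case 0
  then show ?thesis using assms by (simp add: linear_continuous_on)
next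
  case (Suc j)
  show ?thesis unfolding Suc
    by (rule tcd_SucI[where f' = "\<lambda>_. L"])
      (auto intro: tcd_const bounded_linear_imp_has_derivative assms)
qed

lemma tcd_add: "tcd k f \<Longrightarrow> tcd k g \<Longrightarrow> tcd k (\<lambda>x. f x + g x)"
proof (induction k arbitrary: f g)
  case 0
  then show ?case by (auto intro: continuous_intros)
next
  case (Suc k)
  show ?case
    by (rule tcd_SucI, rule has_derivative_add, rule tcd_Suc_has_derivative[OF Suc.prems(1)],
        rule tcd_Suc_has_derivative[OF Suc.prems(2)], rule Suc.IH,
        rule tcd_Suc_frechet[OF Suc.prems(1)], rule tcd_Suc_frechet[OF Suc.prems(2)])
qed

lemma tcd_bilinear:
  assumes "bounded_bilinear B"
  shows "tcd k f \<Longrightarrow> tcd k g \<Longrightarrow> tcd k (\<lambda>x. B (f x) (g x))"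
proof (induction k arbitrary: f g)
  case 0
  then show ?case
    by (auto intro: bounded_bilinear.continuous_on[OF assms])
next
  case (Suc k)
  show ?case
  proof (rule tcd_SucI)
    show "((\<lambda>x. B (f x) (g x)) has_derivative (\<lambda>v. B (f x) (frechet_derivative g (at x) v) +
        B (frechet_derivative f (at x) v) (g x))) (at x)" for x
      using Suc.prems by (intro bounded_bilinear.FDERIV[OF assms] tcd_Suc_has_derivative)
    show "tcd k (\<lambda>x. B (f x) (frechet_derivative g (at x) v) +
        B (frechet_derivative f (at x) v) (g x))" for v
      by (intro tcd_add Suc.IH tcd_Suc_frechet tcd_Suc_imp_tcd[OF Suc.prems(1)]
          tcd_Suc_imp_tcd[OF Suc.prems(2)] Suc.prems)
  qed
qed

lemmas tcd_scaleR = tcd_bilinear[OF bounded_bilinear_scaleR]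
  and tcd_mult = tcd_bilinear[OF bounded_bilinear_mult]
  and tcd_inner = tcd_bilinear[OF bounded_bilinear_inner]

lemma tcd_linear_compose:
  assumes "bounded_linear L" "tcd k f"
  shows "tcd k (\<lambda>x. L (f x))"
  using assms(2)
proof (induction k arbitrary: f)
  case 0
  then show ?case by (auto intro: bounded_linear.continuous_on[OF assms(1)])
next
  case (Suc k)
  show ?case
    by (rule tcd_SucI, rule bounded_linear.has_derivative[OF assms(1)],
        rule tcd_Suc_has_derivative[OF Suc.prems], rule Suc.IH, rule tcd_Suc_frechet[OF Suc.prems])
qed

lemma tcd_diff: "tcd k f \<Longrightarrow> tcd k g \<Longrightarrow> tcd k (\<lambda>x. f x - g x)"
  using tcd_add[of k f "\<lambda>x. - g x"] tcd_linear_compose[OF bounded_linear_minus[OF bounded_linear_ident], of k g]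
  by simp

text \<open>The smoothness predicate differentiates in fixed directions only. With a real-valued
  inner map the chain rule gives a scalar times \<open>frechet_derivative h (at (q x)) 1\<close>,
  again a fixed direction, so the induction closes.\<close>

lemma tcd_real_compose:
  fixes h :: "real \<Rightarrow> 'b::real_normed_vector" and q :: "'a::real_normed_vector \<Rightarrow> real"
  shows "tcd k h \<Longrightarrow> tcd k q \<Longrightarrow> tcd k (\<lambda>x. h (q x))"
proof (induction k arbitrary: h)
  case 0
  then show ?case
    by (auto intro: continuous_on_compose2[of UNIV h])
next
  case (Suc k)
  show ?case
  proof (rule tcd_SucI)
    show "((\<lambda>x. h (q x)) has_derivative
        (\<lambda>v. frechet_derivative q (at x) v *\<^sub>R frechet_derivative h (at (q x)) 1)) (at x)" for x
    proof -
      have h: "(h has_derivative frechet_derivative h (at (q x))) (at (q x))"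
        using tcd_Suc_has_derivative[OF Suc.prems(1)] .
      have "frechet_derivative h (at (q x)) r = r *\<^sub>R frechet_derivative h (at (q x)) 1" for r
        using linear_cmul[OF has_derivative_linear[OF h], of r 1] by simp
      then have "(\<lambda>v. frechet_derivative h (at (q x)) (frechet_derivative q (at x) v)) =
          (\<lambda>v. frechet_derivative q (at x) v *\<^sub>R frechet_derivative h (at (q x)) 1)"
        by blast
      with has_derivative_compose[OF tcd_Suc_has_derivative[OF Suc.prems(2), of x] h]
      show ?thesis by (simp del: times_continuously_differentiable.simps)
    qed
    show "tcd k (\<lambda>x. frechet_derivative q (at x) v *\<^sub>R frechet_derivative h (at (q x)) 1)" for v
      by (intro tcd_scaleR tcd_Suc_frechet[OF Suc.prems(2)] Suc.IH tcd_Suc_frechet[OF Suc.prems(1)]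
          tcd_Suc_imp_tcd[OF Suc.prems(2)])
  qed
qed

lemma tcd_inverse:
  fixes q :: "'a::real_normed_vector \<Rightarrow> real"
  assumes "\<And>x. q x \<noteq> 0"
  shows "tcd k q \<Longrightarrow> tcd k (\<lambda>x. inverse (q x))"
proof (induction k)
  case 0
  then show ?case using assms by (auto intro: continuous_on_inverse)
next
  case (Suc k)
  show ?case
  proof (rule tcd_SucI)
    show "((\<lambda>x. inverse (q x)) has_derivative
        (\<lambda>v. - (inverse (q x) * frechet_derivative q (at x) v * inverse (q x)))) (at x)" for x
      by (rule Deriv.has_derivative_inverse[OF assms tcd_Suc_has_derivative[OF Suc.prems]])
    have *: "tcd k (\<lambda>x. inverse (q x))"
      by (rule Suc.IH[OF tcd_Suc_imp_tcd[OF Suc.prems]])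
    show "tcd k (\<lambda>x. - (inverse (q x) * frechet_derivative q (at x) v * inverse (q x)))" for v
      using * tcd_Suc_frechet[OF Suc.prems]
      by (rule_tac tcd_linear_compose[OF bounded_linear_minus[OF bounded_linear_ident]], rule_tac tcd_mult, rule_tac tcd_mult)
  qed
qed

lemma tcd_exp: "tcd k (exp :: real \<Rightarrow> real)"
proof (induction k)
  case 0
  then show ?case by (simp add: continuous_on_exp)
next
  case (Suc k)
  show ?case
  proof (rule tcd_SucI)
    show "(exp has_derivative (\<lambda>v. exp x * v)) (at x)" for x :: real
      using DERIV_exp[of x] by (simp add: has_field_derivative_def)
    show "tcd k (\<lambda>x. exp x * v)" for v :: real
      by (intro tcd_mult Suc.IH tcd_const)
  qed
qed

text \<open>This is for the field \<open>X\<close> below, whose definition by the floor function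
  agrees with a smooth formula only near each point.\<close>

lemma tcd_local:
  assumes "\<And>x. \<exists>U F. open U \<and> x \<in> U \<and> tcd k F \<and> (\<forall>y\<in>U. f y = F y)"
  shows "tcd k f"
  using assms
proof (induction k arbitrary: f)
  case 0
  have "isCont f x" for x
  proof -
    obtain U F where U: "open U" "x \<in> U" "tcd 0 F" "\<forall>y\<in>U. f y = F y"
      using 0 by blast
    then have "continuous_on U f"
      using continuous_on_subset[OF tcd_continuous_on[OF U(3)], of U] continuous_on_cong[of U U f F]
      by auto
    with U(1,2) show ?thesis by (auto simp: continuous_on_eq_continuous_at)
  qed
  then show ?case by (simp add: continuous_at_imp_continuous_on)
next
  case (Suc k)
  have loc: "(f has_derivative frechet_derivative F (at y)) (at y)"
    if "open U" "tcd (Suc k) F" "\<forall>y\<in>U. f y = F y" "y \<in> U" for U F y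
    by (rule has_derivative_transform_within_open[OF tcd_Suc_has_derivative[OF that(2)] that(1,4)])
      (simp add: that(3))
  have "tcd k (\<lambda>x. frechet_derivative f (at x) v)" for v
  proof (rule Suc.IH)
    fix x
    obtain U F where U: "open U" "x \<in> U" "tcd (Suc k) F" "\<forall>y\<in>U. f y = F y"
      using Suc.prems by blast
    have "\<forall>y\<in>U. frechet_derivative f (at y) v = frechet_derivative F (at y) v"
      using frechet_derivative_at[OF loc[OF U(1,3,4)]] by metis
    with U tcd_Suc_frechet[OF U(3), of v]
    show "\<exists>U G. open U \<and> x \<in> U \<and> tcd k G \<and> (\<forall>y\<in>U. frechet_derivative f (at y) v = G y)"
      by (intro exI[of _ U] exI[of _ "\<lambda>y. frechet_derivative F (at y) v"]) auto
  qed
  moreover have "f differentiable (at x)" for x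
    using Suc.prems[of x] loc unfolding differentiable_def by blast
  ultimately show ?case by simp
qed

section \<open>Flat functions and a smooth step\<close>

text \<open>The family p(1/x) exp (- 1/x), extended by zero, is closed under differentiation; hence
  one induction over all \<open>p\<close> proves smoothness of the standard flat function, the case
  \<open>p = 1\<close>.\<close>

definition flat_poly :: "real poly \<Rightarrow> real \<Rightarrow> real" where
  "flat_poly p x = (if x > 0 then poly p (inverse x) * exp (- inverse x) else 0)"

lemma poly_times_exp_tendsto_0: "((\<lambda>y. poly p y * exp (- y)) \<longlongrightarrow> (0::real)) at_top"
proof -
  have "((\<lambda>y. \<Sum>i\<le>degree p. coeff p i * (y ^ i / exp y)) \<longlongrightarrow> (\<Sum>i\<le>degree p. coeff p i * 0)) at_top"
    by (intro tendsto_intros tendsto_power_div_exp_0)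
  then show ?thesis
    by (simp add: poly_altdef sum_distrib_right exp_minus divide_inverse mult.assoc)
qed

text \<open>With y = 1/x one has dy/dx = - y^2, and differentiating p(y) exp (- y) in y gives (p' -
  p)(y) exp (- y); the factor \<open>monom 1 2\<close> is y^2.\<close>

lemma flat_poly_has_real_derivative:
  "(flat_poly p has_real_derivative flat_poly (monom 1 2 * (p - pderiv p)) x) (at x)"
proof -
  consider "x > 0" | "x < 0" | "x = 0" by linarith
  then show ?thesis
  proof cases
    case 1
    have "((\<lambda>x. poly p (inverse x) * exp (- inverse x)) has_real_derivative
        flat_poly (monom 1 2 * (p - pderiv p)) x) (at x)"
      using 1 by (auto intro!: derivative_eq_intros simp: flat_poly_def poly_monom algebra_simps power2_eq_square)
    then show ?thesis
      by (rule has_field_derivative_transform_within_open[of _ _ _ "{0<..}"])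
        (use 1 in \<open>auto simp: flat_poly_def\<close>)
  next
    case 2
    have "((\<lambda>x. 0) has_real_derivative 0) (at x)" by simp
    then have "(flat_poly p has_real_derivative 0) (at x)"
      by (rule has_field_derivative_transform_within_open[of _ _ _ "{..<0}"])
        (use 2 in \<open>auto simp: flat_poly_def\<close>)
    then show ?thesis using 2 by (simp add: flat_poly_def)
  next
    case 3
    \<comment> \<open>\<open>pCons 0 p\<close> is y p(y): the division by h in the difference
      quotient at 0 is a multiplication by y = 1/h, which the exponential still dominates.\<close>
    have "((\<lambda>x. poly (pCons 0 p) (inverse x) * exp (- inverse x)) \<longlongrightarrow> 0) (at_right (0::real))"
      by (rule filterlim_compose[OF poly_times_exp_tendsto_0 filterlim_inverse_at_top_right])
    then have "((\<lambda>h. (flat_poly p h) / h) \<longlongrightarrow> 0) (at_right (0::real))"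
      by (rule Lim_transform_eventually)
        (auto simp: eventually_at_filter flat_poly_def divide_inverse mult_ac)
    moreover have "((\<lambda>h. (flat_poly p h) / h) \<longlongrightarrow> 0) (at_left (0::real))"
      by (rule Lim_transform_eventually[OF tendsto_const])
        (auto simp: eventually_at_filter flat_poly_def)
    ultimately have "((\<lambda>h. (flat_poly p h) / h) \<longlongrightarrow> 0) (at (0::real))"
      by (simp add: filterlim_at_split)
    then have "(flat_poly p has_real_derivative 0) (at 0)"
      by (simp add: DERIV_def flat_poly_def)
    with 3 show ?thesis by (simp add: flat_poly_def)
  qed
qed

lemma tcd_flat_poly: "tcd k (flat_poly p)"
proof (induction k arbitrary: p)
  case 0
  have "isCont (flat_poly p) x" for x
    by (rule DERIV_isCont[OF flat_poly_has_real_derivative])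
  then show ?case by (simp add: continuous_at_imp_continuous_on)
next
  case (Suc k)
  show ?case
  proof (rule tcd_SucI)
    show "(flat_poly p has_derivative (\<lambda>v. flat_poly (monom 1 2 * (p - pderiv p)) x * v)) (at x)" for x
      using flat_poly_has_real_derivative[of p x] by (simp add: has_field_derivative_def)
    show "tcd k (\<lambda>x. flat_poly (monom 1 2 * (p - pderiv p)) x * v)" for v
      by (intro tcd_mult Suc.IH tcd_const)
  qed
qed

text \<open>The usual quotient of flat functions. The step is completed at 1/2 instead of 1, so that
  the second half of each unit of time stays free of interpolation.\<close>

lemma ex_smooth_step:
  "\<exists>\<theta>::real \<Rightarrow> real. (\<forall>k. tcd k \<theta>) \<and> (\<forall>t\<le>0. \<theta> t = 0) \<and> (\<forall>t\<ge>1/2. \<theta> t = 1)"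
proof -
  define h where "h = flat_poly 1"
  have pos: "h t + h (1/2 - t) > 0" for t
    by (auto simp: h_def flat_poly_def add_pos_pos not_less)
  have "tcd k (\<lambda>t. 1/2 - t)" for k :: nat
    by (intro tcd_diff tcd_const tcd_bounded_linear bounded_linear_ident)
  then have "tcd k (\<lambda>t. h t * inverse (h t + h (1/2 - t)))" for k
    unfolding h_def
    by (intro tcd_mult tcd_inverse tcd_add tcd_flat_poly tcd_real_compose[of k "flat_poly 1"])
      (use pos in \<open>auto simp: h_def less_imp_neq[symmetric]\<close>)
  moreover have "h t * inverse (h t + h (1/2 - t)) = 0" if "t \<le> 0" for t
    using that by (simp add: h_def flat_poly_def)
  moreover have "h t * inverse (h t + h (1/2 - t)) = 1" if "t \<ge> 1/2" for t
    using that by (simp add: h_def flat_poly_def)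
  ultimately show ?thesis by blast
qed

section \<open>Riemannian length and completeness\<close>

definition has_riemannian_length ::
  "('a::euclidean_space \<Rightarrow> 'a \<Rightarrow> 'a \<Rightarrow> real) \<Rightarrow> (real \<Rightarrow> 'a) \<Rightarrow> real \<Rightarrow> bool" where
  "has_riemannian_length g c L \<longleftrightarrow>
     ((\<lambda>t. riemannian_norm g (c t) (vector_derivative c (at t))) has_integral L) {0..1}"

lemma riemannian_norm_nonneg: "riemannian_metric g \<Longrightarrow> 0 \<le> riemannian_norm g x w"
  unfolding riemannian_norm_def riemannian_metric_def
  by (cases "w = 0") (auto simp: bilinear_lzero less_imp_le)

text \<open>All lower bounds on lengths come from this. The bound on \<open>H'\<close> is asked on
  \<open>{a..b}\<close> only, because one of the functions used is controlled only while the path is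
  inside a strip.\<close>

lemma norm_diff_le_riemannian_length:
  fixes H :: "'a::euclidean_space \<Rightarrow> 'b::euclidean_space"
  assumes g: "riemannian_metric g" and c: "valid_path c" "has_riemannian_length g c L"
    and ab: "0 \<le> a" "a \<le> b" "b \<le> 1" and "0 \<le> \<kappa>"
    and H: "\<And>t. t \<in> {a..b} \<Longrightarrow> (H has_derivative H' (c t)) (at (c t))"
    and bound: "\<And>t w. t \<in> {a..b} \<Longrightarrow> norm (H' (c t) w) \<le> \<kappa> * riemannian_norm g (c t) w"
  shows "norm (H (c b) - H (c a)) \<le> \<kappa> * L"
proof -
  obtain S where S: "finite S" "c C1_differentiable_on ({0..1} - S)" and "continuous_on {0..1} c"
    using c(1) by (auto simp: valid_path_def piecewise_C1_differentiable_on_def)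
  define D where "D t = H' (c t) (vector_derivative c (at t))" for t
  define n where "n t = riemannian_norm g (c t) (vector_derivative c (at t))" for t
  have n: "(n has_integral L) {0..1}" "\<And>t. 0 \<le> n t"
    using c(2) riemannian_norm_nonneg[OF g] by (auto simp: n_def[abs_def] has_riemannian_length_def)
  have n_ab: "n integrable_on {a..b}"
    using integrable_on_subinterval[of n "{0..1}" a b] n ab by (auto simp: has_integral_integrable)
  \<comment> \<open>The strong form of the fundamental theorem tolerates the finite set
    \<open>S\<close> of break points.\<close>
  have "(D has_integral H (c b) - H (c a)) {a..b}"
  proof (rule fundamental_theorem_of_calculus_strong[of S a b "\<lambda>t. H (c t)"])
    show "((\<lambda>t. H (c t)) has_vector_derivative D t) (at t)" if t: "t \<in> {a..b} - S" for t
    proof -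
      have "t \<in> {0..1} - S"
        using t ab by auto
      with S(2) have "(c has_vector_derivative vector_derivative c (at t)) (at t)"
        unfolding C1_differentiable_on_eq using vector_derivative_works by blast
      then have "(c has_derivative (\<lambda>s. s *\<^sub>R vector_derivative c (at t))) (at t)"
        by (simp add: has_vector_derivative_def)
      from has_derivative_compose[OF this H] t
      have "((\<lambda>t. H (c t)) has_derivative (\<lambda>s. H' (c t) (s *\<^sub>R vector_derivative c (at t)))) (at t)"
        by auto
      moreover have "linear (H' (c t))"
        using H t has_derivative_linear by blast
      ultimately show ?thesis
        by (simp add: has_vector_derivative_def D_def linear_cmul)
    qed
    show "continuous_on {a..b} (\<lambda>t. H (c t))"
    proof (rule continuous_on_compose2[of "c ` {a..b}" H])
      show "continuous_on (c ` {a..b}) H"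
        using H has_derivative_continuous by (intro continuous_at_imp_continuous_on) blast
      show "continuous_on {a..b} c"
        using \<open>continuous_on {0..1} c\<close> ab by (rule_tac continuous_on_subset) auto
    qed auto
  qed (use S ab in auto)
  moreover from this have "norm (integral {a..b} D) \<le> integral {a..b} (\<lambda>t. \<kappa> * n t)"
    using bound integrable_on_mult_right[OF n_ab, of \<kappa>] by (intro integral_norm_bound_integral)
      (auto simp: D_def n_def has_integral_integrable)
  moreover have "integral {a..b} (\<lambda>t. \<kappa> * n t) \<le> \<kappa> * L"
    using has_integral_subset_le[of "{a..b}" "{0..1}" n "integral {a..b} n" L] n n_ab ab \<open>0 \<le> \<kappa>\<close>
    by (auto simp: integrable_integral intro!: mult_left_mono)
  ultimately show ?thesis
    by (simp add: integral_unique)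
qed

lemma riemannian_metric_continuous:
  "riemannian_metric g \<Longrightarrow> continuous_on UNIV (\<lambda>x. g x u w)"
  unfolding riemannian_metric_def smooth_def using tcd_continuous_on by blast

lemma linepath_has_riemannian_length:
  assumes "riemannian_metric g"
  shows "has_riemannian_length g (linepath x y)
    (integral {0..1} (\<lambda>t. riemannian_norm g (linepath x y t) (y - x)))"
proof -
  have "continuous_on {0..1} (\<lambda>t. riemannian_norm g (linepath x y t) (y - x))"
    unfolding riemannian_norm_def
    by (intro continuous_on_real_sqrt continuous_on_compose2[OF riemannian_metric_continuous[OF assms]])
      (auto intro: continuous_on_linepath)
  then show ?thesis
    by (simp add: has_riemannian_length_def integrable_integral integrable_continuous_real)
qed

lemma riemannian_length_nonneg:
  "riemannian_metric g \<Longrightarrow> has_riemannian_length g c L \<Longrightarrow> 0 \<le> L"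
  unfolding has_riemannian_length_def
  by (rule has_integral_nonneg) (auto intro: riemannian_norm_nonneg)

lemma riemannian_dist_le_length:
  assumes "riemannian_metric g" "valid_path c" "has_riemannian_length g c L"
  shows "riemannian_dist g (pathstart c) (pathfinish c) \<le> L"
  unfolding riemannian_dist_def
proof (rule cInf_lower)
  show "bdd_below {L. \<exists>d. valid_path d \<and> pathstart d = pathstart c \<and> pathfinish d = pathfinish c \<and>
      ((\<lambda>t. riemannian_norm g (d t) (vector_derivative d (at t))) has_integral L) {0..1}}"
    using riemannian_length_nonneg[OF assms(1)]
    by (intro bdd_belowI[of _ 0]) (auto simp: has_riemannian_length_def)
qed (use assms in \<open>auto simp: has_riemannian_length_def\<close>)

lemma riemannian_dist_lessE:
  assumes "riemannian_metric g" "riemannian_dist g x y < e"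
  obtains c L where "valid_path c" "pathstart c = x" "pathfinish c = y"
    "has_riemannian_length g c L" "L < e"
proof -
  let ?S = "{L. \<exists>c. valid_path c \<and> pathstart c = x \<and> pathfinish c = y \<and>
      ((\<lambda>t. riemannian_norm g (c t) (vector_derivative c (at t))) has_integral L) {0..1}}"
  \<comment> \<open>The segment shows that the set of lengths is nonempty, as
    \<open>cInf_lessD\<close> requires.\<close>
  have "integral {0..1} (\<lambda>t. riemannian_norm g (linepath x y t) (y - x)) \<in> ?S"
    using linepath_has_riemannian_length[OF assms(1), of x y]
    unfolding has_riemannian_length_def by (intro CollectI exI[of _ "linepath x y"]) auto
  with assms(2) cInf_lessD[of ?S e] show thesis
    unfolding riemannian_dist_def using that by (auto simp: has_riemannian_length_def)
qed

section \<open>Comparison with the Euclidean norm, and a criterion for completeness\<close>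

text \<open>In the standard basis the norm is bounded by the entries of \<open>g\<close>, which are
  continuous and so bounded on a ball. This will turn Euclidean convergence into convergence of
  \<open>riemannian_dist\<close>.\<close>

lemma riemannian_norm_le_on_cball:
  assumes g: "riemannian_metric (g :: 'a::euclidean_space \<Rightarrow> _)"
  obtains M where "M \<ge> 0" "\<And>x w. x \<in> cball 0 R \<Longrightarrow> riemannian_norm g x w \<le> M * norm w"
proof -
  define G where "G x = (\<Sum>i\<in>Basis. \<Sum>j\<in>Basis. \<bar>g x i j\<bar>)" for x :: 'a
  have "continuous_on (cball 0 R) G"
    unfolding G_def
    by (intro continuous_intros continuous_on_subset[OF riemannian_metric_continuous[OF g]]) auto
  then have "bounded (G ` cball 0 R)"
    by (intro compact_imp_bounded compact_continuous_image compact_cball)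
  then obtain B where B: "\<And>x. x \<in> cball 0 R \<Longrightarrow> \<bar>G x\<bar> \<le> B"
    unfolding bounded_iff by fastforce
  have "riemannian_norm g x w \<le> sqrt \<bar>B\<bar> * norm w" if x: "x \<in> cball 0 R" for x w
  proof -
    have bil: "bilinear (g x)" using g by (simp add: riemannian_metric_def)
    have "g x w w = g x (\<Sum>i\<in>Basis. (w \<bullet> i) *\<^sub>R i) (\<Sum>j\<in>Basis. (w \<bullet> j) *\<^sub>R j)"
      by (simp add: euclidean_representation)
    also have "\<dots> = (\<Sum>(i,j)\<in>Basis \<times> Basis. g x ((w \<bullet> i) *\<^sub>R i) ((w \<bullet> j) *\<^sub>R j))"
      by (rule bilinear_sum[OF bil])
    also have "\<dots> = (\<Sum>i\<in>Basis. \<Sum>j\<in>Basis. (w \<bullet> i) * (w \<bullet> j) * g x i j)"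
      by (simp add: sum.cartesian_product[symmetric] bilinear_lmul[OF bil] bilinear_rmul[OF bil] mult_ac)
    also have "\<dots> \<le> (\<Sum>i\<in>Basis. \<Sum>j\<in>Basis. norm w * norm w * \<bar>g x i j\<bar>)"
    proof (intro sum_mono)
      fix i j :: 'a assume "i \<in> Basis" "j \<in> Basis"
      then have "\<bar>w \<bullet> i\<bar> * \<bar>w \<bullet> j\<bar> \<le> norm w * norm w"
        by (intro mult_mono Basis_le_norm) auto
      then have "\<bar>w \<bullet> i\<bar> * \<bar>w \<bullet> j\<bar> * \<bar>g x i j\<bar> \<le> norm w * norm w * \<bar>g x i j\<bar>"
        by (intro mult_right_mono) auto
      moreover have "(w \<bullet> i) * (w \<bullet> j) * g x i j \<le> \<bar>(w \<bullet> i) * (w \<bullet> j) * g x i j\<bar>"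
        by (rule abs_ge_self)
      ultimately show "(w \<bullet> i) * (w \<bullet> j) * g x i j \<le> norm w * norm w * \<bar>g x i j\<bar>"
        by (simp add: abs_mult)
    qed
    also have "\<dots> = (norm w)\<^sup>2 * G x"
      by (simp add: G_def sum_distrib_left power2_eq_square)
    also have "\<dots> \<le> (norm w)\<^sup>2 * \<bar>B\<bar>"
      using B[OF x] by (intro mult_left_mono) auto
    finally have "sqrt (g x w w) \<le> sqrt ((norm w)\<^sup>2 * \<bar>B\<bar>)"
      by (rule real_sqrt_le_mono)
    then show ?thesis by (simp add: riemannian_norm_def real_sqrt_mult mult.commute)
  qed
  then show thesis by (intro that[of "sqrt \<bar>B\<bar>"]) auto
qed

lemma riemannian_dist_nonneg: "riemannian_metric g \<Longrightarrow> 0 \<le> riemannian_dist g x y"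
  using riemannian_length_nonneg riemannian_dist_lessE
  by (meson linorder_not_less order.strict_iff_not order_le_less_trans)

text \<open>By \<open>lower\<close>, a Cauchy sequence for \<open>riemannian_dist\<close> is
  bounded, then Euclidean Cauchy, and segments to its Euclidean limit bound the Riemannian distance
  from above. The constant may depend on \<open>R\<close> since the tail of the sequence stays in
  one ball.\<close>

lemma complete_riemannian_metricI:
  fixes g :: "'a::euclidean_space \<Rightarrow> 'a \<Rightarrow> 'a \<Rightarrow> real"
  assumes g: "riemannian_metric g"
    and lower: "\<And>R. \<exists>\<kappa>. \<forall>c L. valid_path c \<longrightarrow> has_riemannian_length g c L \<longrightarrow>
      norm (pathstart c) \<le> R \<longrightarrow> L \<le> 1 \<longrightarrow> norm (pathfinish c - pathstart c) \<le> \<kappa> * L"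
  shows "complete_riemannian_metric g"
  unfolding complete_riemannian_metric_def
proof (intro conjI allI impI g)
  have dist_lower: "\<exists>\<kappa>\<ge>0. \<forall>x y e. norm x \<le> R \<longrightarrow> e \<le> 1 \<longrightarrow> riemannian_dist g x y < e \<longrightarrow>
      norm (y - x) \<le> \<kappa> * e" for R
  proof -
    obtain \<kappa> where \<kappa>: "\<And>c L. valid_path c \<Longrightarrow> has_riemannian_length g c L \<Longrightarrow>
        norm (pathstart c) \<le> R \<Longrightarrow> L \<le> 1 \<Longrightarrow> norm (pathfinish c - pathstart c) \<le> \<kappa> * L"
      using lower by blast
    have "norm (y - x) \<le> \<bar>\<kappa>\<bar> * e"
      if x: "norm x \<le> R" and e: "e \<le> 1" "riemannian_dist g x y < e" for x y e
    proof -
      obtain c L where c: "valid_path c" "pathstart c = x" "pathfinish c = y"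
        "has_riemannian_length g c L" "L < e"
        using riemannian_dist_lessE[OF g e(2)] .
      have "norm (y - x) \<le> \<kappa> * L"
        using \<kappa>[OF c(1,4)] c x e by simp
      also have "\<dots> \<le> \<bar>\<kappa>\<bar> * e"
        using c(5) riemannian_length_nonneg[OF g c(4)] by (intro mult_mono) auto
      finally show ?thesis .
    qed
    then show ?thesis by (intro exI[of _ "\<bar>\<kappa>\<bar>"]) auto
  qed
  fix p :: "nat \<Rightarrow> 'a"
  assume "\<forall>e>0. \<exists>N. \<forall>m\<ge>N. \<forall>k\<ge>N. riemannian_dist g (p m) (p k) < e"
  then have Cauchy_g: "\<And>e. e > 0 \<Longrightarrow> \<exists>N. \<forall>m\<ge>N. \<forall>k\<ge>N. riemannian_dist g (p m) (p k) < e"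
    by blast
  obtain N1 where N1: "\<And>m k. m \<ge> N1 \<Longrightarrow> k \<ge> N1 \<Longrightarrow> riemannian_dist g (p m) (p k) < 1"
    using Cauchy_g[of 1] by auto
  obtain \<kappa>1 where \<kappa>1: "\<And>x y e. norm x \<le> norm (p N1) \<Longrightarrow> e \<le> 1 \<Longrightarrow> riemannian_dist g x y < e \<Longrightarrow>
      norm (y - x) \<le> \<kappa>1 * e"
    using dist_lower by blast
  \<comment> \<open>From \<open>N1\<close> on, the sequence stays within distance 1 of
    \<open>p N1\<close>, so the constant for this one ball serves the whole tail.\<close>
  define R where "R = norm (p N1) + \<kappa>1"
  have R: "norm (p m) \<le> R" if "m \<ge> N1" for m
    using \<kappa>1[of "p N1" 1 "p m"] N1[of N1 m] that norm_triangle_sub[of "p m" "p N1"]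
    by (simp add: R_def)
  obtain \<kappa> where \<kappa>: "\<kappa> \<ge> 0" "\<And>x y e. norm x \<le> R \<Longrightarrow> e \<le> 1 \<Longrightarrow> riemannian_dist g x y < e \<Longrightarrow>
      norm (y - x) \<le> \<kappa> * e"
    using dist_lower by blast
  have "Cauchy p"
  proof (rule metric_CauchyI)
    fix e :: real assume e: "e > 0"
    define d where "d = min 1 (e / (2 * (\<kappa> + 1)))"
    have d: "d > 0" "d \<le> 1" using e \<kappa>(1) by (auto simp: d_def)
    have "\<kappa> * d \<le> (\<kappa> + 1) * (e / (2 * (\<kappa> + 1)))"
      using \<kappa>(1) d(1) by (intro mult_mono) (auto simp: d_def)
    also have "\<dots> < e" using \<kappa>(1) e by (simp add: field_simps add_pos_nonneg)
    finally have "\<kappa> * d < e" .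
    obtain N2 where N2: "\<And>m k. m \<ge> N2 \<Longrightarrow> k \<ge> N2 \<Longrightarrow> riemannian_dist g (p m) (p k) < d"
      using Cauchy_g[OF d(1)] by auto
    have "dist (p m) (p k) < e" if "m \<ge> max N1 N2" "k \<ge> max N1 N2" for m k
      using \<kappa>(2)[of "p k" d "p m", OF R d(2) N2] that \<open>\<kappa> * d < e\<close> by (simp add: dist_norm)
    then show "\<exists>M. \<forall>m\<ge>M. \<forall>n\<ge>M. dist (p m) (p n) < e" by blast
  qed
  then obtain q where q: "p \<longlonglongrightarrow> q"
    using Cauchy_convergent convergent_def by blast
  obtain M where M: "M \<ge> 0" "\<And>x w. x \<in> cball 0 (max R (norm q)) \<Longrightarrow> riemannian_norm g x w \<le> M * norm w"
    using riemannian_norm_le_on_cball[OF g, of "max R (norm q)"] by metis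
  have upper: "riemannian_dist g (p m) q \<le> M * norm (q - p m)" if m: "m \<ge> N1" for m
  proof -
    let ?L = "integral {0..1} (\<lambda>t. riemannian_norm g (linepath (p m) q t) (q - p m))"
    have L: "has_riemannian_length g (linepath (p m) q) ?L"
      by (rule linepath_has_riemannian_length[OF g])
    have "riemannian_dist g (p m) q \<le> ?L"
      using riemannian_dist_le_length[OF g _ L] by simp
    also have "\<dots> \<le> integral {0..1::real} (\<lambda>t. M * norm (q - p m))"
    proof (rule integral_le)
      show "(\<lambda>t. riemannian_norm g (linepath (p m) q t) (q - p m)) integrable_on {0..1}"
        using L by (simp add: has_riemannian_length_def has_integral_integrable)
      fix t :: real assume "t \<in> {0..1}"
      then have "linepath (p m) q t \<in> closed_segment (p m) q"
        using linepath_in_path by blast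
      also have "\<dots> \<subseteq> cball 0 (max R (norm q))"
        using R[OF m] by (intro closed_segment_subset) (auto simp: convex_cball)
      finally show "riemannian_norm g (linepath (p m) q t) (q - p m) \<le> M * norm (q - p m)"
        by (rule M(2))
    qed (rule integrable_const_ivl)
    finally show ?thesis by simp
  qed
  have "(\<lambda>m. M * norm (q - p m)) \<longlonglongrightarrow> M * norm (q - q)"
    by (intro tendsto_intros q)
  then have "(\<lambda>m. M * norm (q - p m)) \<longlonglongrightarrow> 0" by simp
  moreover have "\<forall>\<^sub>F m in sequentially. norm (riemannian_dist g (p m) q) \<le> M * norm (q - p m)"
    using upper riemannian_dist_nonneg[OF g] by (auto simp: eventually_sequentially)
  ultimately have "(\<lambda>m. riemannian_dist g (p m) q) \<longlonglongrightarrow> 0"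
    by (rule Lim_null_comparison[rotated])
  then show "\<exists>q. (\<lambda>m. riemannian_dist g (p m) q) \<longlonglongrightarrow> 0" by blast
qed

section \<open>Hyperbolic linear maps\<close>

text \<open>The classical stable space; with \<open>inv T\<close> it is the unstable one. Rate and
  constant may depend on the vector, which makes the subspace property easy; a common rate is
  recovered in \<open>contracted_uniform\<close>.\<close>

definition contracted :: "('a::real_normed_vector \<Rightarrow> 'a) \<Rightarrow> 'a set" where
  "contracted T = {w. \<exists>C \<rho>. 0 < \<rho> \<and> \<rho> < 1 \<and> (\<forall>m. norm ((T ^^ m) w) \<le> C * \<rho> ^ m)}"

lemma contractedI:
  "0 < \<rho> \<Longrightarrow> \<rho> < 1 \<Longrightarrow> (\<And>m. norm ((T ^^ m) w) \<le> C * \<rho> ^ m) \<Longrightarrow> w \<in> contracted T"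
  unfolding contracted_def by blast

lemma contractedE:
  assumes "w \<in> contracted T"
  obtains C \<rho> where "0 < \<rho>" "\<rho> < 1" "0 \<le> C" "\<And>m. norm ((T ^^ m) w) \<le> C * \<rho> ^ m"
proof -
  obtain C \<rho> where *: "0 < \<rho>" "\<rho> < 1" "\<And>m. norm ((T ^^ m) w) \<le> C * \<rho> ^ m"
    using assms by (auto simp: contracted_def)
  moreover have "0 \<le> C"
    using order.trans[OF norm_ge_zero *(3)[of 0]] by simp
  ultimately show thesis by (rule_tac that)
qed

lemma linear_funpow:
  fixes T :: "'a::real_vector \<Rightarrow> 'a"
  shows "linear T \<Longrightarrow> linear (T ^^ m)"
proof (induction m)
  case 0
  then show ?case by (simp add: linear_iff)
next
  case (Suc m)
  then show ?case using linear_compose[of "T ^^ m" T] by (simp add: o_def)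
qed

lemma mult_power_mono:
  "0 \<le> C \<Longrightarrow> 0 \<le> \<rho> \<Longrightarrow> \<rho> \<le> \<sigma> \<Longrightarrow> C * \<rho> ^ m \<le> C * (\<sigma>::real) ^ m"
  by (intro mult_left_mono power_mono) auto

lemma subspace_contracted:
  assumes T: "linear T"
  shows "subspace (contracted T)"
proof (rule subspaceI)
  show "0 \<in> contracted T"
    by (rule contractedI[of "1/2" _ _ 0]) (auto simp: linear_0[OF linear_funpow[OF T]])
next
  fix x y assume "x \<in> contracted T" "y \<in> contracted T"
  then obtain C \<rho> D \<sigma> where x: "0 < \<rho>" "\<rho> < 1" "0 \<le> C" "\<And>m. norm ((T ^^ m) x) \<le> C * \<rho> ^ m"
    and y: "0 < \<sigma>" "\<sigma> < 1" "0 \<le> D" "\<And>m. norm ((T ^^ m) y) \<le> D * \<sigma> ^ m"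
    by (elim contractedE) blast
  show "x + y \<in> contracted T"
  proof (rule contractedI[of "max \<rho> \<sigma>" _ _ "C + D"])
    fix m
    have "norm ((T ^^ m) (x + y)) \<le> norm ((T ^^ m) x) + norm ((T ^^ m) y)"
      by (simp add: linear_add[OF linear_funpow[OF T]] norm_triangle_ineq)
    also have "\<dots> \<le> C * max \<rho> \<sigma> ^ m + D * max \<rho> \<sigma> ^ m"
      using x y by (intro add_mono order.trans[OF x(4) mult_power_mono] order.trans[OF y(4) mult_power_mono]) auto
    finally show "norm ((T ^^ m) (x + y)) \<le> (C + D) * max \<rho> \<sigma> ^ m"
      by (simp add: algebra_simps)
  qed (use x y in auto)
next
  fix c x assume "x \<in> contracted T"
  then obtain C \<rho> where x: "0 < \<rho>" "\<rho> < 1" "0 \<le> C" "\<And>m. norm ((T ^^ m) x) \<le> C * \<rho> ^ m"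
    by (elim contractedE) blast
  show "c *\<^sub>R x \<in> contracted T"
    by (rule contractedI[of \<rho> _ _ "\<bar>c\<bar> * C"])
      (use x in \<open>auto simp: linear_cmul[OF linear_funpow[OF T]] mult.assoc intro: mult_left_mono\<close>)
qed

lemma contracted_image_subset: "w \<in> contracted T \<Longrightarrow> T w \<in> contracted T"
proof (elim contractedE)
  fix C \<rho> assume "0 < \<rho>" "\<rho> < 1" "\<And>m. norm ((T ^^ m) w) \<le> C * \<rho> ^ m"
  then show "T w \<in> contracted T"
    by (intro contractedI[of \<rho> _ _ "C * \<rho>"])
      (use \<open>\<And>m. norm ((T ^^ m) w) \<le> C * \<rho> ^ m\<close>[of "Suc _"] in \<open>auto simp: funpow_swap1 mult_ac\<close>)
qed

text \<open>A comparison of dimensions. This is how a shift of the map by a scalar is later inverted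
  on a stable or unstable space.\<close>

lemma linear_inj_image_subspace_eq:
  fixes f :: "'a::euclidean_space \<Rightarrow> 'a"
  assumes "linear f" "inj_on f S" "subspace S" "f ` S \<subseteq> S"
  shows "f ` S = S"
proof (rule subspace_dim_equal)
  have "span S = S" using assms(3) by (simp only: span_eq_iff)
  then have "inj_on f (span S)" using assms(2) by (simp only:)
  then show "dim S \<le> dim (f ` S)"
    using dim_image_eq[OF assms(1)] by simp
qed (use assms linear_subspace_image in auto)

lemma contracted_image:
  fixes T :: "'a::euclidean_space \<Rightarrow> 'a"
  assumes "linear T" "inj T"
  shows "T ` contracted T = contracted T"
  by (rule linear_inj_image_subspace_eq)
    (use assms contracted_image_subset subspace_contracted in \<open>auto intro: inj_on_subset\<close>)

lemma contracted_inv_image: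
  fixes T :: "'a::euclidean_space \<Rightarrow> 'a"
  assumes "linear T" "bij T"
  shows "T ` contracted (inv T) = contracted (inv T)"
proof -
  have "inv T ` contracted (inv T) = contracted (inv T)"
    using assms by (intro contracted_image inj_linear_imp_inv_linear) (auto simp: bij_is_inj bij_imp_bij_inv)
  then have "T ` contracted (inv T) = T ` inv T ` contracted (inv T)" by simp
  also have "\<dots> = contracted (inv T)"
    using assms(2) by (simp add: image_image surj_f_inv_f bij_is_surj)
  finally show ?thesis .
qed

text \<open>A linear retraction \<open>P\<close> onto the subspace reduces the estimate to the
  finitely many vectors \<open>P i\<close> for basis vectors \<open>i\<close>: the worst of their
  rates and the sum of their constants work for all.\<close>

lemma contracted_uniform:
  fixes T :: "'a::euclidean_space \<Rightarrow> 'a"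
  assumes T: "linear T"
  obtains C \<rho> where "1 \<le> C" "0 < \<rho>" "\<rho> < 1"
    "\<And>w m. w \<in> contracted T \<Longrightarrow> norm ((T ^^ m) w) \<le> C * \<rho> ^ m * norm w"
proof -
  obtain P where P: "range P \<subseteq> contracted T" "linear P" "\<And>w. w \<in> contracted T \<Longrightarrow> P w = w"
    using linear_exists_left_inverse_on[OF linear_ident subspace_contracted[OF T]] by auto
  have "\<exists>C \<rho>. 0 < \<rho> \<and> \<rho> < 1 \<and> 0 \<le> C \<and> (\<forall>m. norm ((T ^^ m) (P i)) \<le> C * \<rho> ^ m)" for i
    using P(1) by (meson contractedE rangeI subsetD)
  then obtain C \<rho> where C: "\<And>i. 0 < \<rho> i" "\<And>i. \<rho> i < (1::real)" "\<And>i. 0 \<le> C i"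
    "\<And>i m. norm ((T ^^ m) (P i)) \<le> C i * \<rho> i ^ m"
    by metis
  define r where "r = Max (\<rho> ` Basis)"
  have r_ge: "\<rho> i \<le> r" if "i \<in> Basis" for i
    using that by (simp add: r_def)
  have "r \<in> \<rho> ` Basis"
    unfolding r_def by (rule Max_in) auto
  then have r: "0 < r" "r < 1" using C(1,2) by auto
  have "norm ((T ^^ m) w) \<le> (1 + sum C Basis) * r ^ m * norm w" if w: "w \<in> contracted T" for w m
  proof -
    have lin: "linear (\<lambda>x. (T ^^ m) (P x))"
      using linear_compose[OF P(2) linear_funpow[OF T, of m]] by (simp add: o_def)
    have "(T ^^ m) w = (T ^^ m) (P (\<Sum>i\<in>Basis. (w \<bullet> i) *\<^sub>R i))"
      by (simp add: euclidean_representation P(3)[OF w])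
    also have "\<dots> = (\<Sum>i\<in>Basis. (w \<bullet> i) *\<^sub>R (T ^^ m) (P i))"
      by (simp add: linear_sum[OF lin] linear_cmul[OF lin])
    finally have "norm ((T ^^ m) w) \<le> (\<Sum>i\<in>Basis. norm ((w \<bullet> i) *\<^sub>R (T ^^ m) (P i)))"
      using norm_sum by metis
    also have "\<dots> \<le> (\<Sum>i\<in>Basis. norm w * (C i * r ^ m))"
    proof (rule sum_mono)
      fix i :: 'a assume i: "i \<in> Basis"
      have "norm ((T ^^ m) (P i)) \<le> C i * r ^ m"
        using C r_ge[OF i] by (meson less_imp_le mult_power_mono order.trans)
      then show "norm ((w \<bullet> i) *\<^sub>R (T ^^ m) (P i)) \<le> norm w * (C i * r ^ m)"
        using Basis_le_norm[OF i, of w] by (auto intro!: mult_mono)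
    qed
    also have "\<dots> = sum C Basis * r ^ m * norm w"
      by (simp add: sum_distrib_left sum_distrib_right mult_ac)
    also have "\<dots> \<le> (1 + sum C Basis) * r ^ m * norm w"
      using r by (intro mult_right_mono) auto
    finally show ?thesis .
  qed
  moreover have "1 \<le> 1 + sum C Basis"
    using C(3) by (simp add: sum_nonneg)
  ultimately show thesis using r that by blast
qed

text \<open>Go forward \<open>m\<close> steps and back again: both moves contract, so
  \<open>norm w\<close> is at most a constant times \<open>(\<sigma> * \<rho>) ^ m\<close>.\<close>

lemma contracted_Int_contracted_inv:
  fixes T :: "'a::euclidean_space \<Rightarrow> 'a"
  assumes T: "linear T" "bij T"
  shows "contracted T \<inter> contracted (inv T) = {0}"
proof -
  have "linear (inv T)"
    using T by (simp add: inj_linear_imp_inv_linear bij_is_inj)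
  obtain C \<rho> where C: "1 \<le> C" "0 < \<rho>" "\<rho> < 1"
    "\<And>w m. w \<in> contracted T \<Longrightarrow> norm ((T ^^ m) w) \<le> C * \<rho> ^ m * norm w"
    using contracted_uniform[OF T(1)] by metis
  obtain D \<sigma> where D: "1 \<le> D" "0 < \<sigma>" "\<sigma> < 1"
    "\<And>w m. w \<in> contracted (inv T) \<Longrightarrow> norm ((inv T ^^ m) w) \<le> D * \<sigma> ^ m * norm w"
    using contracted_uniform[OF \<open>linear (inv T)\<close>] by metis
  have "w = 0" if w: "w \<in> contracted T" "w \<in> contracted (inv T)" for w
  proof -
    have inv: "(T ^^ m) w \<in> contracted (inv T)" for m
    proof (induction m)
      case (Suc m)
      then have "T ((T ^^ m) w) \<in> T ` contracted (inv T)" by (rule imageI)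
      then show ?case by (simp add: contracted_inv_image[OF T])
    qed (simp add: w)
    have "norm w \<le> D * C * norm w * (\<sigma> * \<rho>) ^ m" for m
    proof -
      have "(inv T ^^ m) ((T ^^ m) w) = w"
      proof (induction m)
        case (Suc m)
        then show ?case
          by (simp only: funpow_Suc_right[of m "inv T"] funpow.simps(2)[of m T] o_apply
              inv_f_f[OF bij_is_inj[OF T(2)]])
      qed simp
      then have "norm w \<le> D * \<sigma> ^ m * norm ((T ^^ m) w)"
        using D(4)[OF inv, of m m] by simp
      also have "\<dots> \<le> D * \<sigma> ^ m * (C * \<rho> ^ m * norm w)"
        using D by (intro mult_left_mono C(4) w) auto
      finally show ?thesis by (simp add: power_mult_distrib mult_ac)
    qed
    moreover have "(\<lambda>m. D * C * norm w * (\<sigma> * \<rho>) ^ m) \<longlonglongrightarrow> D * C * norm w * 0"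
      using C D mult_strict_mono[of \<sigma> 1 \<rho> 1]
      by (intro tendsto_intros LIMSEQ_power_zero) auto
    ultimately have "norm w \<le> D * C * norm w * 0"
      by (intro LIMSEQ_le_const) auto
    then show "w = 0" by simp
  qed
  moreover have "0 \<in> contracted T" "0 \<in> contracted (inv T)"
    using subspace_contracted[OF T(1)] subspace_contracted[OF \<open>linear (inv T)\<close>] subspace_0 by auto
  ultimately show ?thesis by blast
qed

section \<open>Splitting a complex space by eigenvalue shifts\<close>

lemma norm_vector_smult: "norm (c *s x) = norm c * norm x"
  for x :: "'a::real_normed_div_algebra ^ 'n"
  by (simp add: norm_vec_def norm_mult L2_set_right_distrib)

lemma linear_vector_smult: "linear (\<lambda>x. c *s x)" for c :: complex
  by (rule linearI) (simp_all add: vec_eq_iff algebra_simps)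

text \<open>The scalar recursion \<open>T\<^sup>m\<^sup>+\<^sup>1 z = \<mu> T\<^sup>m z + T\<^sup>m s\<close> transfers decay from \<open>s\<close> to \<open>z\<close>.\<close>

lemma contracted_eigen_shift:
  fixes T :: "complex ^ 'n \<Rightarrow> complex ^ 'n"
  assumes T: "linear T" and smult: "\<And>c x. T (c *s x) = c *s T x"
    and "norm \<mu> < 1" and "T z - \<mu> *s z \<in> contracted T"
  shows "z \<in> contracted T"
proof -
  define s where "s = T z - \<mu> *s z"
  obtain C \<rho> where C: "0 < \<rho>" "\<rho> < 1" "0 \<le> C" "\<And>m. norm ((T ^^ m) s) \<le> C * \<rho> ^ m"
    using contractedE assms(4) unfolding s_def by metis
  \<comment> \<open>A rate strictly above both avoids a factor growing with \<open>m\<close> when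
    \<open>norm \<mu> = \<rho>\<close>. \<open>D\<close> is then chosen to satisfy
    \<open>norm \<mu> * D + C \<le> D * \<sigma>\<close>, which is the induction step.\<close>
  obtain \<sigma> where \<sigma>: "norm \<mu> < \<sigma>" "\<rho> < \<sigma>" "\<sigma> < 1"
    using dense[of "max (norm \<mu>) \<rho>" 1] assms(3) C(2) by auto
  define D where "D = norm z + C / (\<sigma> - norm \<mu>)"
  have D: "norm z \<le> D" "C \<le> D * (\<sigma> - norm \<mu>)"
    using \<sigma> C by (simp_all add: D_def distrib_right)
  have pow_smult: "(T ^^ m) (c *s x) = c *s (T ^^ m) x" for m c x
    by (induction m) (auto simp: smult)
  have "norm ((T ^^ m) z) \<le> D * \<sigma> ^ m" for m
  proof (induction m)
    case (Suc m)
    have "(T ^^ Suc m) z = (T ^^ m) (\<mu> *s z + s)"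
      by (simp add: funpow_swap1 s_def)
    also have "\<dots> = \<mu> *s (T ^^ m) z + (T ^^ m) s"
      by (simp add: linear_add[OF linear_funpow[OF T]] pow_smult)
    finally have "norm ((T ^^ Suc m) z) \<le> norm \<mu> * norm ((T ^^ m) z) + norm ((T ^^ m) s)"
      by (metis norm_triangle_ineq norm_vector_smult)
    also have "\<dots> \<le> norm \<mu> * (D * \<sigma> ^ m) + C * \<sigma> ^ m"
      using C \<sigma> by (intro add_mono mult_left_mono Suc.IH order.trans[OF C(4) mult_power_mono]) auto
    also have "\<dots> \<le> norm \<mu> * (D * \<sigma> ^ m) + D * (\<sigma> - norm \<mu>) * \<sigma> ^ m"
      using D C \<sigma> by (intro add_left_mono mult_right_mono) auto
    finally show ?case by (simp add: algebra_simps)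
  qed (use D in simp)
  then show ?thesis
    using \<sigma> C by (intro contractedI[of \<sigma>]) auto
qed

lemma eigenvector_notin_contracted:
  fixes T :: "complex ^ 'n \<Rightarrow> complex ^ 'n"
  assumes smult: "\<And>c x. T (c *s x) = c *s T x"
    and "1 \<le> norm \<mu>" "T y = \<mu> *s y" "y \<in> contracted T"
  shows "y = 0"
proof -
  obtain C \<rho> where C: "0 < \<rho>" "\<rho> < 1" "0 \<le> C" "\<And>m. norm ((T ^^ m) y) \<le> C * \<rho> ^ m"
    using contractedE assms(4) by metis
  have "(T ^^ m) y = (\<mu> ^ m) *s y" for m
    by (induction m) (simp_all add: smult assms(3) vector_smult_assoc mult.commute)
  then have "norm y \<le> C * \<rho> ^ m" for m
    using C(4)[of m] one_le_power[OF assms(2), of m] mult_right_mono[of 1 "norm \<mu> ^ m" "norm y"]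
    by (simp add: norm_vector_smult norm_power)
  moreover have "(\<lambda>m. C * \<rho> ^ m) \<longlonglongrightarrow> C * 0"
    using C by (intro tendsto_intros LIMSEQ_power_zero) auto
  ultimately have "norm y \<le> C * 0"
    by (intro LIMSEQ_le_const) auto
  then show ?thesis by simp
qed

lemma contracted_smult:
  fixes T :: "complex ^ 'n \<Rightarrow> complex ^ 'n"
  assumes smult: "\<And>c x. T (c *s x) = c *s T x" and "x \<in> contracted T"
  shows "c *s x \<in> contracted T"
proof -
  obtain C \<rho> where C: "0 < \<rho>" "\<rho> < 1" "0 \<le> C" "\<And>m. norm ((T ^^ m) x) \<le> C * \<rho> ^ m"
    using contractedE assms(2) by metis
  have "(T ^^ m) (c *s x) = c *s (T ^^ m) x" for m
    by (induction m) (auto simp: smult)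
  with C show ?thesis
    by (intro contractedI[of \<rho> _ _ "norm c * C"]) (auto simp: norm_vector_smult mult.assoc intro: mult_left_mono)
qed

text \<open>The sequence may repeat values, whereas \<open>dependent\<close> speaks of sets; a
  repetition \<open>u i = u j\<close> gives the relation with coefficients 1 and -1.\<close>

lemma ex_linear_relation:
  fixes u :: "nat \<Rightarrow> 'a::euclidean_space"
  shows "\<exists>c. (\<exists>i\<le>DIM('a). c i \<noteq> 0) \<and> (\<Sum>i\<le>DIM('a). c i *\<^sub>R u i) = 0"
proof (cases "inj_on u {..DIM('a)}")
  case True
  then have "dependent (u ` {..DIM('a)})"
    by (intro dependent_biggerset) (simp add: card_image)
  then obtain c where c: "\<exists>v\<in>u ` {..DIM('a)}. c v \<noteq> 0" "(\<Sum>v\<in>u ` {..DIM('a)}. c v *\<^sub>R v) = 0"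
    by (auto simp: dependent_finite)
  with True show ?thesis
    by (intro exI[of _ "\<lambda>i. c (u i)"]) (auto simp: sum.reindex)
next
  case False
  then obtain i j where ij: "i \<le> DIM('a)" "j \<le> DIM('a)" "i \<noteq> j" "u i = u j"
    by (auto simp: inj_on_def)
  let ?c = "\<lambda>k. (if k = i then 1 else 0) - (if k = j then 1 else 0) :: real"
  have "(\<Sum>k\<le>DIM('a). ?c k *\<^sub>R u k) = 0"
    using ij by (simp add: scaleR_left_diff_distrib sum_subtractf if_distrib[of "\<lambda>c. c *\<^sub>R _"] sum.delta cong: if_cong)
  with ij show ?thesis
    by (intro exI[of _ ?c]) auto
qed

text \<open>\<open>linear\<close> is linearity over the reals, so \<open>smult_B\<close> supplies
  complex linearity. Complex scalars let polynomials in \<open>B\<close> split into linear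
  factors.\<close>

locale complex_hyperbolic =
  fixes B :: "complex ^ 'n \<Rightarrow> complex ^ 'n"
  assumes linear_B: "linear B" and bij_B: "bij B" and smult_B: "\<And>c x. B (c *s x) = c *s B x"
    and hyperbolic_B: "\<And>z w. norm z = 1 \<Longrightarrow> B w = z *s w \<Longrightarrow> w = 0"
begin

lemma linear_inv_B: "linear (inv B)"
  using linear_B bij_B by (simp add: inj_linear_imp_inv_linear bij_is_inj)

lemma B_inv_B [simp]: "B (inv B x) = x" and inv_B_B [simp]: "inv B (B x) = x"
  using bij_B by (simp_all add: surj_f_inv_f bij_is_surj bij_is_inj)

lemma smult_inv_B: "inv B (c *s x) = c *s inv B x"
  by (metis B_inv_B inv_B_B smult_B)

definition splits :: "(complex ^ 'n) set" where
  "splits = {a + b | a b. a \<in> contracted B \<and> b \<in> contracted (inv B)}"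

lemma linear_B_shift: "linear (\<lambda>x. B x - \<mu> *s x)"
  by (intro linear_compose_sub linear_B linear_vector_smult)

text \<open>The shift preserves the stable space and is injective there, because a nonzero decaying
  eigenvector has an eigenvalue of modulus below one.\<close>

lemma shift_image_contracted:
  assumes "1 \<le> norm \<mu>"
  shows "(\<lambda>x. B x - \<mu> *s x) ` contracted B = contracted B"
proof (rule linear_inj_image_subspace_eq[OF linear_B_shift])
  show sub: "subspace (contracted B)"
    by (rule subspace_contracted[OF linear_B])
  show "inj_on (\<lambda>x. B x - \<mu> *s x) (contracted B)"
    using eigenvector_notin_contracted[OF smult_B assms]
    by (subst linear_inj_on_iff_eq_0[OF linear_B_shift sub]) auto
  show "(\<lambda>x. B x - \<mu> *s x) ` contracted B \<subseteq> contracted B"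
    using sub contracted_image_subset contracted_smult[OF smult_B] by (auto intro!: subspace_diff)
qed

text \<open>An eigenvector of \<open>B\<close> for a nonzero \<open>\<mu>\<close> is one of
  \<open>inv B\<close> for the reciprocal, whose modulus is at least one; it cannot decay under
  \<open>inv B\<close>.\<close>

lemma shift_image_contracted_inv:
  assumes "norm \<mu> \<le> 1"
  shows "(\<lambda>x. B x - \<mu> *s x) ` contracted (inv B) = contracted (inv B)"
proof (rule linear_inj_image_subspace_eq[OF linear_B_shift])
  show sub: "subspace (contracted (inv B))"
    by (rule subspace_contracted[OF linear_inv_B])
  have "y = 0" if y: "y \<in> contracted (inv B)" "B y = \<mu> *s y" for y
  proof (cases "\<mu> = 0")
    case True
    then have "B y = B 0" using y(2) linear_0[OF linear_B] by simp
    then show ?thesis using bij_is_inj[OF bij_B] by (simp add: inj_eq)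
  next
    case False
    have "inv B (B y) = inv B (\<mu> *s y)"
      using y(2) by (rule arg_cong)
    then have "y = \<mu> *s inv B y"
      by (simp add: smult_inv_B)
    then have "inverse \<mu> *s y = inverse \<mu> *s (\<mu> *s inv B y)"
      by (rule arg_cong)
    then have "inv B y = inverse \<mu> *s y"
      using False by (simp add: vector_smult_assoc)
    moreover have "1 \<le> norm (inverse \<mu>)"
      using assms False by (simp add: norm_inverse one_le_inverse_iff)
    ultimately show ?thesis
      using eigenvector_notin_contracted[OF smult_inv_B] y(1) by blast
  qed
  then show "inj_on (\<lambda>x. B x - \<mu> *s x) (contracted (inv B))"
    by (subst linear_inj_on_iff_eq_0[OF linear_B_shift sub]) auto
  show "(\<lambda>x. B x - \<mu> *s x) ` contracted (inv B) \<subseteq> contracted (inv B)"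
    using sub contracted_inv_image[OF linear_B bij_B] contracted_smult[OF smult_inv_B]
    by (auto intro!: subspace_diff)
qed

text \<open>Write the shifted vector as s + u. If \<open>norm \<mu> < 1\<close>, the shift can be
  solved for u on the unstable space, and \<open>contracted_eigen_shift\<close> shows that the rest
  is stable; \<open>norm \<mu> > 1\<close> is the mirror image. If \<open>norm \<mu> = 1\<close>,
  both parts can be solved for, and what is left is an eigenvector, which hyperbolicity excludes
  unless it is zero.\<close>

lemma splits_if_shift_splits:
  assumes "B y - \<mu> *s y \<in> splits"
  shows "y \<in> splits"
proof -
  obtain s u where su: "B y - \<mu> *s y = s + u" "s \<in> contracted B" "u \<in> contracted (inv B)"
    using assms by (auto simp: splits_def)
  have zero: "0 \<in> contracted B" "0 \<in> contracted (inv B)"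
    using subspace_contracted[OF linear_B] subspace_contracted[OF linear_inv_B] subspace_0 by auto
  have lift_s: "\<exists>s'\<in>contracted B. B s' - \<mu> *s s' = s" if "1 \<le> norm \<mu>"
    using shift_image_contracted[OF that] su(2) by (metis (no_types, lifting) image_iff)
  have lift_u: "\<exists>u'\<in>contracted (inv B). B u' - \<mu> *s u' = u" if "norm \<mu> \<le> 1"
    using shift_image_contracted_inv[OF that] su(3) by (metis (no_types, lifting) image_iff)
  note shift_diff = linear_diff[OF linear_B_shift[of \<mu>]]
  consider "norm \<mu> < 1" | "norm \<mu> > 1" | "norm \<mu> = 1" by linarith
  then show ?thesis
  proof cases
    case 1
    then obtain u' where u': "u' \<in> contracted (inv B)" "B u' - \<mu> *s u' = u"
      using lift_u by auto
    have "B (y - u') - \<mu> *s (y - u') = s"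
      using shift_diff[of y u'] su(1) u'(2) by simp
    with su(2) have "B (y - u') - \<mu> *s (y - u') \<in> contracted B"
      by (simp only:)
    then have "y - u' \<in> contracted B"
      by (rule contracted_eigen_shift[OF linear_B smult_B 1])
    with u'(1) show ?thesis
      unfolding splits_def by (intro CollectI exI[of _ "y - u'"] exI[of _ u']) auto
  next
    case 2
    then obtain s' where s': "s' \<in> contracted B" "B s' - \<mu> *s s' = s"
      using lift_s by auto
    define z where "z = y - s'"
    \<comment> \<open>Rewritten for \<open>inv B\<close>, the shift is by
      \<open>inverse \<mu>\<close>, of modulus below one, so the decay of \<open>u\<close> under
      \<open>inv B\<close> passes to \<open>z\<close>.\<close>
    have "B z = \<mu> *s z + u"
      using shift_diff[of y s'] su(1) s'(2) by (simp add: z_def algebra_simps)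
    then have "inv B (B z) = inv B (\<mu> *s z + u)"
      by (rule arg_cong)
    then have "z = \<mu> *s inv B z + inv B u"
      by (simp add: linear_add[OF linear_inv_B] smult_inv_B)
    then have "inverse \<mu> *s z = inverse \<mu> *s (\<mu> *s inv B z + inv B u)"
      by (rule arg_cong)
    moreover have "\<mu> \<noteq> 0"
      using 2 by auto
    ultimately have "inverse \<mu> *s z = inv B z + inverse \<mu> *s inv B u"
      by (simp add: vector_add_ldistrib vector_smult_assoc)
    then have "inv B z - inverse \<mu> *s z = (- inverse \<mu>) *s inv B u"
      by (simp add: vector_smult_lneg)
    also have "\<dots> \<in> contracted (inv B)"
      by (intro contracted_smult smult_inv_B contracted_image_subset su(3))
    finally have "inv B z - inverse \<mu> *s z \<in> contracted (inv B)" .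
    moreover have "norm (inverse \<mu>) < 1"
      using 2 by (simp add: norm_inverse inverse_less_1_iff)
    ultimately have "z \<in> contracted (inv B)"
      by (rule contracted_eigen_shift[OF linear_inv_B smult_inv_B, rotated])
    with s'(1) show ?thesis
      unfolding splits_def z_def by (intro CollectI exI[of _ s'] exI[of _ "y - s'"]) auto
  next
    case 3
    then obtain s' u' where s': "s' \<in> contracted B" "B s' - \<mu> *s s' = s"
      and u': "u' \<in> contracted (inv B)" "B u' - \<mu> *s u' = u"
      using lift_s lift_u by auto
    have "B (y - s' - u') - \<mu> *s (y - s' - u') = 0"
      unfolding shift_diff su(1) s'(2) u'(2) by simp
    then have "B (y - s' - u') = \<mu> *s (y - s' - u')"
      by (simp only: right_minus_eq)
    then have "y - s' - u' = 0"
      by (rule hyperbolic_B[OF 3])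
    then have "y = s' + u'" by (simp add: algebra_simps)
    with s'(1) u'(1) show ?thesis
      unfolding splits_def by blast
  qed
qed

text \<open>This is p(B) w when \<open>degree p < N\<close>. An explicit cutoff instead of the
  degree makes multiplication by a linear factor a plain shift of indices.\<close>

definition poly_act :: "nat \<Rightarrow> complex poly \<Rightarrow> complex ^ 'n \<Rightarrow> complex ^ 'n" where
  "poly_act N p w = (\<Sum>i<N. coeff p i *s (B ^^ i) w)"

lemma poly_act_linear_factor:
  assumes "degree q < N"
  shows "poly_act (Suc N) ([:-\<mu>, 1:] * q) w = B (poly_act N q w) - \<mu> *s poly_act N q w"
proof -
  have "[:-\<mu>, 1:] * q = pCons 0 q - smult \<mu> q"
    by (simp add: mult_pCons_left)
  then have "poly_act (Suc N) ([:-\<mu>, 1:] * q) w =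
      (\<Sum>i<Suc N. coeff (pCons 0 q) i *s (B ^^ i) w) - (\<Sum>i<Suc N. (\<mu> * coeff q i) *s (B ^^ i) w)"
    by (simp add: poly_act_def vector_sub_rdistrib sum_subtractf)
  also have "(\<Sum>i<Suc N. coeff (pCons 0 q) i *s (B ^^ i) w) = B (poly_act N q w)"
    by (subst sum.lessThan_Suc_shift) (simp add: poly_act_def linear_sum[OF linear_B] smult_B)
  also have "(\<Sum>i<Suc N. (\<mu> * coeff q i) *s (B ^^ i) w) = \<mu> *s poly_act N q w"
    using assms by (simp add: poly_act_def linear_sum[OF linear_vector_smult] vector_smult_assoc coeff_eq_0)
  finally show ?thesis .
qed

text \<open>The fundamental theorem of algebra peels off one linear factor at a time, and
  \<open>splits_if_shift_splits\<close> carries membership back through it; a nonzero constant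
  remains.\<close>

lemma splits_if_poly_act_splits:
  "p \<noteq> 0 \<Longrightarrow> degree p < N \<Longrightarrow> poly_act N p w \<in> splits \<Longrightarrow> w \<in> splits"
proof (induction "degree p" arbitrary: p N)
  case 0
  obtain c where p: "p = [:c:]" using 0(1) by (metis degree_eq_zeroE)
  have "poly_act N p w = (\<Sum>i<N. if i = 0 then c *s w else 0)"
    unfolding poly_act_def p by (rule sum.cong) (auto simp: coeff_pCons split: nat.split)
  then have "poly_act N p w = c *s w"
    using 0 by (simp add: sum.delta)
  then obtain a b where ab: "c *s w = a + b" "a \<in> contracted B" "b \<in> contracted (inv B)"
    using 0(4) by (auto simp: splits_def)
  have "w = inverse c *s (c *s w)"
    using 0(2) p by (simp add: vector_smult_assoc)
  then have "w = inverse c *s a + inverse c *s b"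
    by (simp add: ab(1) vector_add_ldistrib)
  moreover have "inverse c *s a \<in> contracted B" "inverse c *s b \<in> contracted (inv B)"
    using contracted_smult[OF smult_B ab(2)] contracted_smult[OF smult_inv_B ab(3)] by auto
  ultimately show ?case
    unfolding splits_def by blast
next
  case (Suc d)
  then have "\<not> constant (poly p)"
    by (simp add: constant_degree)
  then obtain z where "poly p z = 0"
    using fundamental_theorem_of_algebra by blast
  then obtain q where q: "p = [:-z, 1:] * q"
    by (auto simp: poly_eq_0_iff_dvd)
  with Suc.prems(1) have "q \<noteq> 0" by auto
  then have "degree p = Suc (degree q)"
    unfolding q by (subst degree_mult_eq) auto
  then have deg: "degree q = d" "degree q < N - 1" "N = Suc (N - 1)"
    using Suc by auto
  have "B (poly_act (N - 1) q w) - z *s poly_act (N - 1) q w \<in> splits"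
    using poly_act_linear_factor[OF deg(2)] Suc.prems(3) deg(3) q by metis
  then have "poly_act (N - 1) q w \<in> splits"
    by (rule splits_if_shift_splits)
  then show ?case
    using Suc.hyps(1)[of q "N - 1"] deg \<open>q \<noteq> 0\<close> by simp
qed

text \<open>The iterates of \<open>w\<close> up to the real dimension are too many to be
  independent, so a nonzero polynomial in \<open>B\<close> sends \<open>w\<close> to 0, which lies
  in \<open>splits\<close>.\<close>

lemma splits_UNIV: "w \<in> splits"
proof -
  let ?N = "DIM(complex ^ 'n)"
  obtain c where c: "\<exists>i\<le>?N. c i \<noteq> 0" "(\<Sum>i\<le>?N. c i *\<^sub>R (B ^^ i) w) = 0"
    using ex_linear_relation[of "\<lambda>i. (B ^^ i) w"] by auto
  define p where "p = (\<Sum>i\<le>?N. monom (complex_of_real (c i)) i)"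
  have coeff: "coeff p i = (if i \<le> ?N then complex_of_real (c i) else 0)" for i
    by (simp add: p_def coeff_sum sum.delta)
  have "p \<noteq> 0"
    using c(1) coeff by (metis coeff_0 of_real_eq_0_iff)
  moreover have "degree p < Suc ?N"
    using degree_le[of ?N p] coeff by (simp add: less_Suc_eq_le)
  moreover have "poly_act (Suc ?N) p w = (\<Sum>i\<le>?N. c i *\<^sub>R (B ^^ i) w)"
    unfolding poly_act_def lessThan_Suc_atMost
    by (rule sum.cong) (simp_all add: coeff vec_eq_iff scaleR_conv_of_real[where 'a = complex])
  moreover have "0 \<in> splits"
    unfolding splits_def using subspace_0 subspace_contracted[OF linear_B] subspace_contracted[OF linear_inv_B]
    by force
  ultimately show ?thesis
    using splits_if_poly_act_splits c(2) by metis
qed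

end

section \<open>Descent to real matrices\<close>

lemma bij_matrix_vector_mult:
  fixes A :: "'a::field ^ 'n ^ 'n"
  assumes "invertible A"
  shows "bij ((*v) A)"
proof -
  obtain A' where "A ** A' = mat 1" "A' ** A = mat 1"
    using assms by (auto simp: invertible_def)
  then show ?thesis
    by (intro o_bij[of "(*v) A'"]) (auto simp: o_def matrix_vector_mul_assoc)
qed

text \<open>Taking real parts intertwines \<open>B\<close> with \<open>T\<close> and does not
  increase norms, so decay descends from the complexification.\<close>

lemma contracted_Re:
  fixes T :: "real ^ 'n \<Rightarrow> real ^ 'n" and B :: "complex ^ 'n \<Rightarrow> complex ^ 'n"
  assumes "\<And>w. (\<chi> i. Re (B w $ i)) = T (\<chi> i. Re (w $ i))" and "w \<in> contracted B"
  shows "(\<chi> i. Re (w $ i)) \<in> contracted T"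
proof -
  obtain C \<rho> where C: "0 < \<rho>" "\<rho> < 1" "0 \<le> C" "\<And>m. norm ((B ^^ m) w) \<le> C * \<rho> ^ m"
    using contractedE assms(2) by metis
  have "(T ^^ m) (\<chi> i. Re (w $ i)) = (\<chi> i. Re ((B ^^ m) w $ i))" for m
    by (induction m) (simp_all add: assms(1))
  moreover have "norm (\<chi> i. Re (x $ i)) \<le> norm x" for x :: "complex ^ 'n"
  proof -
    have "norm (\<chi> i. Re (x $ i)) = L2_set (\<lambda>i. norm (Re (x $ i))) UNIV"
      by (simp add: norm_vec_def)
    also have "\<dots> \<le> L2_set (\<lambda>i. norm (x $ i)) UNIV"
      by (rule L2_set_mono) (auto simp: abs_Re_le_cmod)
    finally show ?thesis by (simp add: norm_vec_def)
  qed
  ultimately show ?thesis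
    using C by (intro contractedI[of \<rho> _ _ C]) (auto intro: order.trans)
qed

lemma hyperbolic_matrix_splitting:
  fixes A :: "real ^ 'n ^ 'n"
  assumes "invertible A" "hyperbolic_matrix A"
  shows "\<exists>a\<in>contracted ((*v) A). \<exists>b\<in>contracted (inv ((*v) A)). x = a + b"
proof -
  define B where "B = (*v) (map_matrix complex_of_real A)"
  have map_mult: "map_matrix complex_of_real (M ** N) = map_matrix complex_of_real M ** map_matrix complex_of_real N"
    for M N :: "real ^ 'n ^ 'n"
    by (simp add: vec_eq_iff matrix_matrix_mult_def)
  have map_one: "map_matrix complex_of_real (mat 1 :: real ^ 'n ^ 'n) = mat 1"
    by (simp add: vec_eq_iff mat_def)
  have "invertible (map_matrix complex_of_real A)"
    using assms(1) unfolding invertible_def by (metis map_mult map_one)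
  then have bij: "bij B"
    unfolding B_def by (rule bij_matrix_vector_mult)
  interpret complex_hyperbolic B
  proof (rule complex_hyperbolic.intro)
    show "linear B" by (simp add: B_def bounded_linear.linear)
    fix c z :: complex and x w :: "complex ^ 'n"
    show "B (c *s x) = c *s B x"
      by (simp add: B_def vector_scalar_commute)
    show "w = 0" if "norm z = 1" "B w = z *s w"
      using assms(2) that unfolding hyperbolic_matrix_def Spec_def B_def by (auto simp: set_eq_iff)
  qed (rule bij)
  let ?Re = "\<lambda>w :: complex ^ 'n. \<chi> i. Re (w $ i)"
  have Re_B: "?Re (B w) = A *v ?Re w" for w
    by (simp add: B_def vec_eq_iff matrix_vector_mult_def)
  have Re_inv: "?Re (inv B w) = inv ((*v) A) (?Re w)" for w
    using Re_B[of "inv B w"] bij_is_inj[OF bij_matrix_vector_mult[OF assms(1)]] by (simp add: inv_f_eq)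
  obtain a b where ab: "(\<chi> i. complex_of_real (x $ i)) = a + b" "a \<in> contracted B" "b \<in> contracted (inv B)"
    using splits_UNIV[of "\<chi> i. complex_of_real (x $ i)"] by (auto simp: splits_def)
  have "x = ?Re (a + b)"
    by (simp add: ab(1)[symmetric])
  also have "\<dots> = ?Re a + ?Re b"
    by (simp add: vec_eq_iff)
  finally show ?thesis
    using contracted_Re[OF Re_B ab(2)] contracted_Re[OF Re_inv ab(3)] by blast
qed

section \<open>Affine maps with a fixed point\<close>

lemma continuous_subbundle_const:
  assumes "subspace (S :: 'a::euclidean_space set)"
  shows "continuous_subbundle (\<lambda>_. S)"
proof -
  obtain B where B: "B \<subseteq> S" "independent B" "S \<subseteq> span B"
    using maximal_independent_subset by blast
  have "span B = S"
    using B assms span_minimal by blast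
  moreover obtain h where h: "bij_betw h {..<card B} B"
    using ex_bij_betw_nat_finite[OF independent_imp_finite[OF B(2)]] by (auto simp: atLeast0LessThan)
  then have "inj_on h {..<card B}" "h ` {..<card B} = B"
    by (auto simp: bij_betw_def)
  ultimately show ?thesis
    unfolding continuous_subbundle_def using B(2)
    by (intro allI exI[of _ UNIV] exI[of _ "card B"] exI[of _ "\<lambda>i _. h i"]) auto
qed

lemma funpow_has_derivative:
  fixes f :: "'a::real_normed_vector \<Rightarrow> 'a"
  assumes "\<And>x. (f has_derivative L) (at x)"
  shows "((f ^^ m) has_derivative (L ^^ m)) (at x)"
proof (induction m arbitrary: x)
  case (Suc m)
  from has_derivative_compose[OF Suc assms] show ?case
    by (simp add: o_def)
qed (simp add: id_def has_derivative_ident)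

lemma tcd_if_constant_derivative:
  assumes "\<And>x. (f has_derivative D) (at x)"
  shows "tcd k f"
proof (cases k)
  case 0
  then show ?thesis
    using has_derivative_continuous[OF assms] by (simp add: continuous_at_imp_continuous_on)
next
  case (Suc j)
  show ?thesis unfolding Suc by (rule tcd_SucI[OF assms tcd_const])
qed

lemma bij_affine: "bij L \<Longrightarrow> bij (\<lambda>x. L x + v)" for v :: "'a::ab_group_add"
  by (rule o_bij[of "\<lambda>y. inv L (y - v)"]) (auto simp: o_def bij_is_inj surj_f_inv_f bij_is_surj)

lemma inv_affine: "bij L \<Longrightarrow> inv (\<lambda>x. L x + v) = (\<lambda>y. inv L (y - v))" for v :: "'a::ab_group_add"
  by (rule inv_equality) (auto simp: bij_is_inj surj_f_inv_f bij_is_surj)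

lemma affine_has_derivative:
  fixes L :: "'a::euclidean_space \<Rightarrow> 'a"
  assumes "linear L"
  shows "((\<lambda>x. L x + v) has_derivative L) (at x)"
  using linear_imp_has_derivative[OF assms] by (auto intro!: derivative_eq_intros)

lemma inv_affine_has_derivative:
  fixes L :: "'a::euclidean_space \<Rightarrow> 'a"
  assumes "linear L" "bij L"
  shows "(inv (\<lambda>x. L x + v) has_derivative inv L) (at x)"
proof -
  have lin: "linear (inv L)"
    using assms by (simp add: inj_linear_imp_inv_linear bij_is_inj)
  have "inv (\<lambda>x. L x + v) = (\<lambda>y. inv L y + (- inv L v))"
    by (simp add: inv_affine[OF assms(2)] linear_diff[OF lin])
  then show ?thesis
    using affine_has_derivative[OF lin, of "- inv L v"] by simp
qed

lemma diffeomorphism_affine: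
  fixes L :: "'a::euclidean_space \<Rightarrow> 'a"
  assumes "linear L" "bij L"
  shows "diffeomorphism (\<lambda>x. L x + v)"
  unfolding diffeomorphism_def smooth_def
  by (intro conjI allI bij_affine assms tcd_if_constant_derivative[OF affine_has_derivative[OF assms(1)]]
      tcd_if_constant_derivative[OF inv_affine_has_derivative[OF assms]])

lemma affine_frechet_derivatives:
  fixes L :: "'a::euclidean_space \<Rightarrow> 'a"
  assumes "linear L" "bij L"
  shows "frechet_derivative (\<lambda>x. L x + v) (at x) = L"
    and "frechet_derivative ((\<lambda>x. L x + v) ^^ m) (at x) = L ^^ m"
    and "frechet_derivative (inv (\<lambda>x. L x + v) ^^ m) (at x) = inv L ^^ m"
  using frechet_derivative_at[OF affine_has_derivative[OF assms(1)]]
    frechet_derivative_at[OF funpow_has_derivative[OF affine_has_derivative[OF assms(1)]]]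
    frechet_derivative_at[OF funpow_has_derivative[OF inv_affine_has_derivative[OF assms]]]
  by simp_all

section \<open>Bounded orbits at a fixed point\<close>

text \<open>Here \<open>q\<close> is a squared norm. The forward orbit of \<open>u\<close> is the
  difference of a bounded orbit and a stable one, hence bounded; pulling it back by
  \<open>unstable\<close> bounds \<open>q u\<close> by a constant times \<open>l ^ m\<close>. An
  abstract \<open>L\<close> allows reuse for the inverse with the two spaces exchanged.\<close>

lemma unstable_component_zero:
  fixes L :: "'a::real_vector \<Rightarrow> 'a"
  assumes L: "linear L" "bij L"
    and q: "\<And>x. 0 \<le> q x" "\<And>x. q x = 0 \<Longrightarrow> x = 0" "\<And>x y. q (x - y) \<le> 2 * q x + 2 * q y"
    and inv: "L ` Eu \<subseteq> Eu" and l: "0 < l" "l < (1::real)"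
    and stable: "\<And>m w. w \<in> Es \<Longrightarrow> q ((L ^^ m) w) \<le> C * l ^ m * q w"
    and unstable: "\<And>m w. w \<in> Eu \<Longrightarrow> q ((inv L ^^ m) w) \<le> C * l ^ m * q w" and "0 \<le> C"
    and bounded: "\<And>m. q ((L ^^ m) (s + u)) \<le> K" and su: "s \<in> Es" "u \<in> Eu"
  shows "u = 0"
proof -
  have Eu: "(L ^^ m) u \<in> Eu" for m
    using inv by (induction m) (auto simp: su)
  have "q u \<le> C * (2 * K + 2 * (C * q s)) * l ^ m" for m
  proof -
    have "(inv L ^^ m) ((L ^^ m) u) = u"
    proof (induction m)
      case (Suc m)
      then show ?case
        by (simp only: funpow_Suc_right[of m "inv L"] funpow.simps(2)[of m L] o_apply
            inv_f_f[OF bij_is_inj[OF L(2)]])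
    qed simp
    then have "q u \<le> C * l ^ m * q ((L ^^ m) u)"
      using unstable[OF Eu, of m m] by simp
    also have "(L ^^ m) u = (L ^^ m) (s + u) - (L ^^ m) s"
      by (simp add: linear_add[OF linear_funpow[OF L(1)]])
    also have "C * l ^ m * q \<dots> \<le> C * l ^ m * (2 * K + 2 * (C * q s))"
    proof (rule mult_left_mono)
      have "q ((L ^^ m) s) \<le> C * l ^ m * q s"
        by (rule stable[OF su(1)])
      also have "\<dots> \<le> C * 1 * q s"
        using l q(1) \<open>0 \<le> C\<close> by (intro mult_right_mono mult_left_mono) (auto intro: power_le_one)
      finally show "q ((L ^^ m) (s + u) - (L ^^ m) s) \<le> 2 * K + 2 * (C * q s)"
        using q(3)[of "(L ^^ m) (s + u)" "(L ^^ m) s"] bounded[of m] by simp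
    qed (use l \<open>0 \<le> C\<close> in auto)
    finally show ?thesis
      by (simp add: mult_ac)
  qed
  moreover have "(\<lambda>m. C * (2 * K + 2 * (C * q s)) * l ^ m) \<longlonglongrightarrow> C * (2 * K + 2 * (C * q s)) * 0"
    using l by (intro tendsto_intros LIMSEQ_power_zero) auto
  ultimately have "q u \<le> C * (2 * K + 2 * (C * q s)) * 0"
    by (intro LIMSEQ_le_const) auto
  then show ?thesis
    using q(1)[of u] q(2)[of u] by simp
qed

text \<open>If \<open>a\<close> and \<open>b\<close> are the real and imaginary part of an
  eigenvector for x + iy, then \<alpha> + i\<beta> is the m-th power of x + iy and keeps modulus
  one.\<close>

lemma rotation_funpow:
  fixes L :: "'a::real_vector \<Rightarrow> 'a"
  assumes L: "linear L" and xy: "x\<^sup>2 + y\<^sup>2 = 1"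
    and ab: "L a = x *\<^sub>R a - y *\<^sub>R b" "L b = y *\<^sub>R a + x *\<^sub>R b"
  shows "\<exists>\<alpha> \<beta>. \<alpha>\<^sup>2 + \<beta>\<^sup>2 = 1 \<and> (L ^^ m) a = \<alpha> *\<^sub>R a - \<beta> *\<^sub>R b"
proof (induction m)
  case 0
  show ?case by (intro exI[of _ 1] exI[of _ 0]) simp
next
  case (Suc m)
  then obtain \<alpha> \<beta> where IH: "\<alpha>\<^sup>2 + \<beta>\<^sup>2 = 1" "(L ^^ m) a = \<alpha> *\<^sub>R a - \<beta> *\<^sub>R b"
    by blast
  have "(\<alpha> * x - \<beta> * y)\<^sup>2 + (\<alpha> * y + \<beta> * x)\<^sup>2 = (\<alpha>\<^sup>2 + \<beta>\<^sup>2) * (x\<^sup>2 + y\<^sup>2)"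
    by (simp add: power2_eq_square algebra_simps)
  moreover have "(L ^^ Suc m) a = (\<alpha> * x - \<beta> * y) *\<^sub>R a - (\<alpha> * y + \<beta> * x) *\<^sub>R b"
    by (simp add: IH(2) linear_diff[OF L] linear_cmul[OF L] ab algebra_simps)
  ultimately show ?case
    using IH(1) xy by auto
qed

text \<open>Equivalent to \<open>0 \<le> g p (x + y) (x + y)\<close>; it plays the part of the
  triangle inequality for squared norms.\<close>

lemma riemannian_metric_parallelogram:
  assumes "riemannian_metric g"
  shows "g p (x - y) (x - y) \<le> 2 * g p x x + 2 * g p y y"
proof -
  have bil: "bilinear (g p)" and pos: "0 \<le> g p (x + y) (x + y)"
    using assms by (auto simp: riemannian_metric_def)
      (metis bilinear_lzero less_imp_le order_refl)
  then show ?thesis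
    by (simp add: bilinear_ladd[OF bil] bilinear_radd[OF bil] bilinear_lsub[OF bil] bilinear_rsub[OF bil])
qed

lemma riemannian_norm_power2:
  assumes "riemannian_metric g"
  shows "(riemannian_norm g p w)\<^sup>2 = g p w w"
proof -
  have "0 \<le> g p w w"
    using assms by (auto simp: riemannian_metric_def) (metis bilinear_lzero less_imp_le order_refl)
  then show ?thesis by (simp add: riemannian_norm_def)
qed

lemma anosov_fixed_point_imp_no_rotation:
  fixes L :: "'a::euclidean_space \<Rightarrow> 'a"
  assumes L: "linear L" "bij L" and g: "riemannian_metric g"
    and anosov: "anosov g (\<lambda>x. L x + v)" and p: "L p + v = p"
    and xy: "x\<^sup>2 + y\<^sup>2 = 1"
    and ab: "L a = x *\<^sub>R a - y *\<^sub>R b" "L b = y *\<^sub>R a + x *\<^sub>R b"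
  shows "a = 0"
proof -
  let ?f = "\<lambda>x. L x + v"
  obtain Es Eu C l where split: "continuous_splitting Es Eu"
    and inv: "derivative_invariant ?f Es" "derivative_invariant ?f Eu"
    and C: "1 \<le> C" "0 < l" "l < 1"
    and s: "\<And>m x w. w \<in> Es x \<Longrightarrow> riemannian_norm g ((?f ^^ m) x) (frechet_derivative (?f ^^ m) (at x) w)
      \<le> C * l ^ m * riemannian_norm g x w"
    and u: "\<And>m x w. w \<in> Eu x \<Longrightarrow> riemannian_norm g ((inv ?f ^^ m) x) (frechet_derivative (inv ?f ^^ m) (at x) w)
      \<le> C * l ^ m * riemannian_norm g x w"
    using anosov unfolding anosov_def by blast
  have inv_p: "inv ?f p = p"
    by (rule inv_f_eq[OF bij_is_inj[OF bij_affine[OF L(2)]]]) (rule p)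
  have fixed: "(?f ^^ m) p = p" "(inv ?f ^^ m) p = p" for m
    by (induction m) (auto simp: p inv_p)
  define q where "q w = g p w w" for w
  have sq: "q w' \<le> C\<^sup>2 * (l\<^sup>2) ^ m * q w" if "riemannian_norm g p w' \<le> C * l ^ m * riemannian_norm g p w" for w w' m
    using power_mono[OF that riemannian_norm_nonneg[OF g], of 2]
    by (simp add: riemannian_norm_power2[OF g] q_def power_mult_distrib power_mult[symmetric] mult.commute)
  have stable: "q ((L ^^ m) w) \<le> C\<^sup>2 * (l\<^sup>2) ^ m * q w" if "w \<in> Es p" for m w
    using sq s[OF that, of m] by (simp add: affine_frechet_derivatives[OF L] fixed)
  have unstable: "q ((inv L ^^ m) w) \<le> C\<^sup>2 * (l\<^sup>2) ^ m * q w" if "w \<in> Eu p" for m w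
    using sq u[OF that, of m] by (simp add: affine_frechet_derivatives[OF L] fixed)
  have L_Es: "L ` Es p = Es p" and L_Eu: "L ` Eu p = Eu p"
    using inv by (simp_all add: derivative_invariant_def affine_frechet_derivatives[OF L])
      (metis p)+
  have inv_L_Es: "inv L ` Es p \<subseteq> Es p"
    using L_Es bij_is_inj[OF L(2)] by (metis image_inv_f_f subset_refl)
  have q_nonneg: "0 \<le> q w" for w
    by (simp add: q_def flip: riemannian_norm_power2[OF g])
  have q_zero: "q w = 0 \<Longrightarrow> w = 0" for w
    using g unfolding q_def riemannian_metric_def by (metis less_irrefl)
  have q_diff: "q (w - w') \<le> 2 * q w + 2 * q w'" for w w'
    unfolding q_def by (rule riemannian_metric_parallelogram[OF g])
  note q = q_nonneg q_zero q_diff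
  have q_scale: "q (r *\<^sub>R w) = r\<^sup>2 * q w" for r w
    using g by (simp add: q_def riemannian_metric_def bilinear_lmul bilinear_rmul power2_eq_square)
  have rot_bound: "q (\<alpha> *\<^sub>R a - \<beta> *\<^sub>R b) \<le> 2 * q a + 2 * q b" if "\<alpha>\<^sup>2 + \<beta>\<^sup>2 = 1" for \<alpha> \<beta>
  proof -
    have "\<alpha>\<^sup>2 * q a \<le> q a" "\<beta>\<^sup>2 * q b \<le> q b"
      using that q(1) mult_right_mono[of "\<alpha>\<^sup>2" 1 "q a"] mult_right_mono[of "\<beta>\<^sup>2" 1 "q b"]
      by (smt (verit) zero_le_power2 mult_cancel_right2)+
    then show ?thesis
      using q(3)[of "\<alpha> *\<^sub>R a" "\<beta> *\<^sub>R b"] by (simp add: q_scale)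
  qed
  have lin_inv: "linear (inv L)"
    using L by (simp add: inj_linear_imp_inv_linear bij_is_inj)
  \<comment> \<open>The inverse rotates by the conjugate number, so \<open>rotation_funpow\<close>
    applies to it with \<open>- y\<close>.\<close>
  have inv_ab: "inv L a = x *\<^sub>R a - (- y) *\<^sub>R b" "inv L b = (- y) *\<^sub>R a + x *\<^sub>R b"
  proof -
    have "L (x *\<^sub>R a - (- y) *\<^sub>R b) = (x\<^sup>2 + y\<^sup>2) *\<^sub>R a"
      "L ((- y) *\<^sub>R a + x *\<^sub>R b) = (x\<^sup>2 + y\<^sup>2) *\<^sub>R b"
      by (simp_all add: linear_add[OF L(1)] linear_diff[OF L(1)] linear_neg[OF L(1)] linear_cmul[OF L(1)] ab power2_eq_square algebra_simps)
    then show "inv L a = x *\<^sub>R a - (- y) *\<^sub>R b" "inv L b = (- y) *\<^sub>R a + x *\<^sub>R b"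
      using xy by (auto intro!: inv_f_eq[OF bij_is_inj[OF L(2)]])
  qed
  have fwd: "q ((L ^^ m) a) \<le> 2 * q a + 2 * q b" for m
    using rotation_funpow[OF L(1) xy ab, of m] rot_bound by auto
  have bwd: "q ((inv L ^^ m) a) \<le> 2 * q a + 2 * q b" for m
    using rotation_funpow[OF lin_inv _ inv_ab, of m] xy rot_bound by auto
  obtain s' u' where su: "a = s' + u'" "s' \<in> Es p" "u' \<in> Eu p"
    using split unfolding continuous_splitting_def by blast
  have l2: "0 < l\<^sup>2" "l\<^sup>2 < 1" "0 \<le> C\<^sup>2"
    using C by (auto simp: power_less_one_iff)
  have "u' = 0"
    by (rule unstable_component_zero[OF L q _ l2(1,2) stable unstable l2(3) _ su(2,3)])
      (use L_Eu fwd su in auto)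
  \<comment> \<open>The same lemma for \<open>inv L\<close>, with the stable and unstable spaces
    exchanged.\<close>
  moreover have "s' = 0"
    by (rule unstable_component_zero[OF lin_inv bij_imp_bij_inv[OF L(2)] q _ l2(1,2) unstable _ l2(3) _ su(3,2)])
      (use inv_L_Es bwd su stable inv_inv_eq[OF L(2)] in \<open>auto simp: add.commute\<close>)
  ultimately show ?thesis using su(1) by simp
qed

lemma anosov_fixed_point_imp_hyperbolic:
  fixes A :: "real ^ 'n ^ 'n"
  assumes "invertible A" "riemannian_metric g" "anosov g (affine_map A v)" "affine_map A v p = p"
  shows "hyperbolic_matrix A"
proof (rule ccontr)
  assume "\<not> hyperbolic_matrix A"
  then obtain z w where z: "norm z = 1" and w: "w \<noteq> 0" "map_matrix complex_of_real A *v w = z *s w"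
    by (auto simp: hyperbolic_matrix_def Spec_def)
  define a b where "a = (\<chi> i. Re (w $ i))" and "b = (\<chi> i. Im (w $ i))"
  have comp: "(\<Sum>j\<in>UNIV. complex_of_real (A $ i $ j) * w $ j) = z * w $ i" for i
    using w(2) by (simp add: vec_eq_iff matrix_vector_mult_def)
  have "(\<Sum>j\<in>UNIV. A $ i $ j * a $ j) = Re z * a $ i - Im z * b $ i"
    and "(\<Sum>j\<in>UNIV. A $ i $ j * b $ j) = Im z * a $ i + Re z * b $ i" for i
    using arg_cong[OF comp[of i], of Re] arg_cong[OF comp[of i], of Im] by (simp_all add: a_def b_def)
  then have ab: "A *v a = Re z *\<^sub>R a - Im z *\<^sub>R b" "A *v b = Im z *\<^sub>R a + Re z *\<^sub>R b"
    by (simp_all add: vec_eq_iff matrix_vector_mult_def)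
  \<comment> \<open>The pair (b, a) satisfies the same relations with \<open>- Im z\<close>, so the
    lemma that kills the real part also kills the imaginary part.\<close>
  then have ba: "A *v b = Re z *\<^sub>R b - (- Im z) *\<^sub>R a" "A *v a = (- Im z) *\<^sub>R b + Re z *\<^sub>R a"
    by simp_all
  have xy: "(Re z)\<^sup>2 + (Im z)\<^sup>2 = 1" "(Re z)\<^sup>2 + (- Im z)\<^sup>2 = 1"
    using z cmod_power2[of z] by simp_all
  have lin: "linear ((*v) A)" by simp
  note no_rotation = anosov_fixed_point_imp_no_rotation[OF lin bij_matrix_vector_mult[OF assms(1)] assms(2)
      assms(3)[unfolded affine_map_def[abs_def]] assms(4)[unfolded affine_map_def]]
  have "a = 0" "b = 0"
    using no_rotation[OF xy(1) ab] no_rotation[OF xy(2) ba] by auto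
  then have "w = 0"
    by (simp add: a_def b_def vec_eq_iff complex_eq_iff)
  with w(1) show False by simp
qed

lemma complete_euclidean_metric: "complete_riemannian_metric (\<lambda>_. (\<bullet>) :: 'a::euclidean_space \<Rightarrow> _)"
proof (rule complete_riemannian_metricI)
  show metric: "riemannian_metric (\<lambda>_. (\<bullet>) :: 'a \<Rightarrow> _)"
    unfolding riemannian_metric_def smooth_def
    by (auto simp: tcd_const inner_commute bilinear_conv_bounded_bilinear bounded_bilinear_inner)
  fix R
  show "\<exists>\<kappa>. \<forall>c L. valid_path c \<longrightarrow> has_riemannian_length (\<lambda>_. (\<bullet>) :: 'a \<Rightarrow> _) c L \<longrightarrow>
      norm (pathstart c) \<le> R \<longrightarrow> L \<le> 1 \<longrightarrow> norm (pathfinish c - pathstart c) \<le> \<kappa> * L"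
    using norm_diff_le_riemannian_length[OF metric, of _ _ 0 1 1 "\<lambda>x. x" "\<lambda>_ x. x"]
    by (intro exI[of _ 1]) (auto simp: pathstart_def pathfinish_def riemannian_norm_def norm_eq_sqrt_inner)
qed

lemma hyperbolic_imp_anosov_euclidean:
  fixes A :: "real ^ 'n ^ 'n"
  assumes "invertible A" "hyperbolic_matrix A"
  shows "anosov (\<lambda>_. (\<bullet>)) (affine_map A v)"
proof -
  define L where "L = (*v) A"
  have L: "linear L" "bij L"
    using bij_matrix_vector_mult[OF assms(1)] by (simp_all add: L_def)
  have inv_L: "linear (inv L)"
    using L by (simp add: inj_linear_imp_inv_linear bij_is_inj)
  have f: "affine_map A v = (\<lambda>x. L x + v)"
    by (simp add: affine_map_def[abs_def] L_def)
  obtain C \<rho> where C: "1 \<le> C" "0 < \<rho>" "\<rho> < 1"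
    "\<And>w m. w \<in> contracted L \<Longrightarrow> norm ((L ^^ m) w) \<le> C * \<rho> ^ m * norm w"
    using contracted_uniform[OF L(1)] by metis
  obtain D \<sigma> where D: "1 \<le> D" "0 < \<sigma>" "\<sigma> < 1"
    "\<And>w m. w \<in> contracted (inv L) \<Longrightarrow> norm ((inv L ^^ m) w) \<le> D * \<sigma> ^ m * norm w"
    using contracted_uniform[OF inv_L] by metis
  have mono: "C * \<rho> ^ m * r \<le> max C D * max \<rho> \<sigma> ^ m * r" "D * \<sigma> ^ m * r \<le> max C D * max \<rho> \<sigma> ^ m * r"
    if "0 \<le> r" for m r
    using C D that by (auto intro!: mult_right_mono mult_mono power_mono)
  have "continuous_splitting (\<lambda>_. contracted L) (\<lambda>_. contracted (inv L))"
    unfolding continuous_splitting_def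
    using hyperbolic_matrix_splitting[OF assms] contracted_Int_contracted_inv[OF L]
    by (auto simp: L_def[symmetric] set_eq_iff
        intro!: continuous_subbundle_const subspace_contracted L inv_L) blast
  moreover have "derivative_invariant (\<lambda>x. L x + v) (\<lambda>_. contracted L)"
    "derivative_invariant (\<lambda>x. L x + v) (\<lambda>_. contracted (inv L))"
    unfolding derivative_invariant_def affine_frechet_derivatives[OF L]
    using contracted_image[OF L(1) bij_is_inj[OF L(2)]] contracted_inv_image[OF L] by auto
  moreover have "norm ((L ^^ m) w) \<le> max C D * max \<rho> \<sigma> ^ m * norm w" if "w \<in> contracted L" for m w
    using C(4)[OF that] mono(1)[OF norm_ge_zero] order.trans by blast
  moreover have "norm ((inv L ^^ m) w) \<le> max C D * max \<rho> \<sigma> ^ m * norm w" if "w \<in> contracted (inv L)" for m w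
    using D(4)[OF that] mono(2)[OF norm_ge_zero] order.trans by blast
  ultimately show ?thesis
    unfolding anosov_def f using diffeomorphism_affine[OF L] C D
    by (intro conjI exI[of _ "\<lambda>_. contracted L"] exI[of _ "\<lambda>_. contracted (inv L)"]
        exI[of _ "max C D"] exI[of _ "max \<rho> \<sigma>"])
      (auto simp: affine_frechet_derivatives[OF L] riemannian_norm_def norm_eq_sqrt_inner[symmetric])
qed

section \<open>Affine maps without a fixed point\<close>

text \<open>The strips of time are indexed by all integers, so iterates of either sign are treated
  uniformly.\<close>

definition int_funpow :: "int \<Rightarrow> ('a \<Rightarrow> 'a) \<Rightarrow> 'a \<Rightarrow> 'a" where
  "int_funpow m h = (if 0 \<le> m then h ^^ nat m else inv h ^^ nat (- m))"

lemma int_funpow_plus_one: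
  assumes "bij h"
  shows "int_funpow (m + 1) h x = h (int_funpow m h x)"
proof (cases "0 \<le> m")
  case True
  then have "nat (m + 1) = Suc (nat m)" by simp
  with True show ?thesis by (simp add: int_funpow_def)
next
  case False
  then obtain k where k: "m = - 1 - int k"
    by (intro that[of "nat (- m - 1)"]) simp
  then have "nat (- m) = Suc k" "nat (- (m + 1)) = k" by simp_all
  with False show ?thesis
    using assms k by (cases "k = 0") (simp_all add: int_funpow_def surj_f_inv_f bij_is_surj)
qed

lemma int_funpow_commute:
  assumes "bij h"
  shows "int_funpow m h (h x) = int_funpow (m + 1) h x"
proof (induction m rule: int_induct[where k = 0])
  case base
  show ?case by (simp add: int_funpow_def)
next
  case (step1 i)
  then show ?case
    by (simp only: int_funpow_plus_one[OF assms])
next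
  case (step2 i)
  have "h (int_funpow (i - 1) h (h x)) = h (int_funpow (i - 1 + 1) h x)"
    using int_funpow_plus_one[OF assms, of "i - 1"] step2(2) int_funpow_plus_one[OF assms, of i]
    by simp
  then show ?case
    using bij_is_inj[OF assms] by (simp add: inj_eq)
qed

lemma int_funpow_has_derivative:
  fixes f :: "'a::real_normed_vector \<Rightarrow> 'a"
  assumes "\<And>x. (f has_derivative L) (at x)" "\<And>x. (inv f has_derivative inv L) (at x)"
  shows "(int_funpow m f has_derivative int_funpow m L) (at x)"
  by (simp add: int_funpow_def funpow_has_derivative[OF assms(1)] funpow_has_derivative[OF assms(2)])

text \<open>Take \<open>s\<close> as the first time at the lower level and \<open>r\<close> as the
  last time before \<open>s\<close> at the upper level; by the intermediate value theorem the path
  cannot leave the band in between.\<close>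

lemma crossing_interval:
  fixes \<phi> :: "real \<Rightarrow> real"
  assumes cont: "continuous_on {0..b} \<phi>" and "0 \<le> b" and ends: "\<beta> \<le> \<phi> 0" "\<phi> b \<le> \<alpha>" "\<alpha> \<le> \<beta>"
  obtains r s where "0 \<le> r" "r \<le> s" "s \<le> b" "\<phi> r = \<beta>" "\<phi> s = \<alpha>" "\<And>t. t \<in> {r..s} \<Longrightarrow> \<alpha> \<le> \<phi> t \<and> \<phi> t \<le> \<beta>"
proof -
  have closed: "compact {t \<in> {x..y}. \<phi> t = c}" if "0 \<le> x" "y \<le> b" for x y c
  proof -
    have "continuous_on {x..y} \<phi>"
      using that by (intro continuous_on_subset[OF cont]) auto
    then have "closed ({x..y} \<inter> \<phi> -` {c})"
      by (intro continuous_closed_preimage) auto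
    moreover have "{t \<in> {x..y}. \<phi> t = c} = {x..y} \<inter> ({x..y} \<inter> \<phi> -` {c})" by auto
    ultimately show ?thesis by (metis compact_Icc compact_Int_closed)
  qed
  have ivt: "\<exists>t. x \<le> t \<and> t \<le> y \<and> \<phi> t = c" if "0 \<le> x" "x \<le> y" "y \<le> b" "\<phi> y \<le> c" "c \<le> \<phi> x" for x y c
    using that by (intro IVT2') (auto intro: continuous_on_subset[OF cont])
  have "{t \<in> {0..b}. \<phi> t = \<alpha>} \<noteq> {}"
    using ivt[of 0 b \<alpha>] assms by auto
  then obtain s where s: "0 \<le> s" "s \<le> b" "\<phi> s = \<alpha>" "\<And>t. 0 \<le> t \<Longrightarrow> t \<le> b \<Longrightarrow> \<phi> t = \<alpha> \<Longrightarrow> s \<le> t"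
    using compact_attains_inf[OF closed[of 0 b \<alpha>]] by auto
  have "{t \<in> {0..s}. \<phi> t = \<beta>} \<noteq> {}"
    using ivt[of 0 s \<beta>] s assms by auto
  then obtain r where r: "0 \<le> r" "r \<le> s" "\<phi> r = \<beta>" "\<And>t. 0 \<le> t \<Longrightarrow> t \<le> s \<Longrightarrow> \<phi> t = \<beta> \<Longrightarrow> t \<le> r"
    using compact_attains_sup[OF closed[of 0 s \<beta>]] s by auto
  have "\<alpha> \<le> \<phi> t \<and> \<phi> t \<le> \<beta>" if t: "t \<in> {r..s}" for t
  proof (rule ccontr)
    assume "\<not> (\<alpha> \<le> \<phi> t \<and> \<phi> t \<le> \<beta>)"
    then consider "\<phi> t < \<alpha>" | "\<beta> < \<phi> t" by linarith
    then show False
    proof cases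
      case 1
      then obtain t' where "r \<le> t'" "t' \<le> t" "\<phi> t' = \<alpha>"
        using ivt[of r t \<alpha>] r s t ends by auto
      then have "s \<le> t'" using r(1) t s by (intro s(4)) auto
      with \<open>t' \<le> t\<close> t have "t = s" by auto
      with 1 s(3) show False by simp
    next
      case 2
      then obtain t' where "t \<le> t'" "t' \<le> s" "\<phi> t' = \<beta>"
        using ivt[of t s \<beta>] r s t ends by auto
      then have "t' \<le> r" using r(1) t by (intro r(4)) auto
      with \<open>t \<le> t'\<close> t have "t = r" by auto
      with 2 r(3) show False by simp
    qed
  qed
  with r s show thesis by (intro that) auto
qed

text \<open>
  The coordinate \<open>a \<bullet> x\<close> is the time: the affine map advances it by one. The vector field \<open>X\<close>
  is invariant and has unit speed in time. While the fractional part of the time lies in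
  \<open>[1/2, 1]\<close>, the quantity \<open>s\<close> satisfies \<open>s' = 8 (1 + s\<^sup>2)\<close> along \<open>X\<close>, so that every
  integral curve escapes to infinity.
\<close>

locale fixed_point_free =
  fixes L :: "'a::euclidean_space \<Rightarrow> 'a" and v a e :: 'a and \<theta> :: "real \<Rightarrow> real" and K :: real
  assumes linear_L: "linear L" and bij_L: "bij L"
    and a_L: "\<And>x. a \<bullet> L x = a \<bullet> x" and a_v: "a \<bullet> v = 1"
    and norm_e: "norm e = 1" and a_e: "a \<bullet> e = 0"
    and \<theta>_smooth: "\<And>k. tcd k \<theta>" and \<theta>_0: "\<And>t. t \<le> 0 \<Longrightarrow> \<theta> t = 0" and \<theta>_1: "\<And>t. t \<ge> 1/2 \<Longrightarrow> \<theta> t = 1"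
    and K: "1 \<le> K" "\<And>x. norm (L x) \<le> K * norm x" "\<And>x. norm (inv L x) \<le> K * norm x"
begin

definition f :: "'a \<Rightarrow> 'a" where "f = (\<lambda>x. L x + v)"

definition s :: "int \<Rightarrow> 'a \<Rightarrow> real" where "s m x = e \<bullet> int_funpow (- m) f x"

text \<open>The term \<open>v - (v \<bullet> e) *\<^sub>R e\<close> gives unit speed in time and has
  no component along \<open>e\<close>; hence \<open>s m\<close> grows along \<open>Y m\<close> at
  exactly the rate of the last term. The outer \<open>int_funpow m L\<close> lets the map carry
  \<open>Y m\<close> to \<open>Y (m + 1)\<close>.\<close>

definition Y :: "int \<Rightarrow> 'a \<Rightarrow> 'a" where
  "Y m x = int_funpow m L (v - (v \<bullet> e) *\<^sub>R e + (8 * (1 + (s m x)\<^sup>2)) *\<^sub>R e)"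

text \<open>The first half of each unit of time passes from \<open>Y (m - 1)\<close> to
  \<open>Y m\<close>; in the second half the field is \<open>Y m\<close> itself.\<close>

definition X :: "'a \<Rightarrow> 'a" where
  "X x = (let m = \<lfloor>a \<bullet> x\<rfloor>; r = \<theta> (a \<bullet> x - m) in r *\<^sub>R Y m x + (1 - r) *\<^sub>R Y (m - 1) x)"

lemma linear_inv_L: "linear (inv L)"
  using linear_L bij_L by (simp add: inj_linear_imp_inv_linear bij_is_inj)

lemma bij_f: "bij f"
  unfolding f_def by (rule bij_affine[OF bij_L])

lemma f_has_derivative: "(f has_derivative L) (at x)" and inv_f_has_derivative: "(inv f has_derivative inv L) (at x)"
  unfolding f_def by (rule affine_has_derivative[OF linear_L] inv_affine_has_derivative[OF linear_L bij_L])+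

lemma linear_int_funpow: "linear (int_funpow m L)"
  by (simp add: int_funpow_def linear_funpow linear_L linear_inv_L)

lemma a_int_funpow: "a \<bullet> int_funpow m L w = a \<bullet> w"
proof -
  have "a \<bullet> (L ^^ k) w = a \<bullet> w" for k
    by (induction k) (simp_all add: a_L)
  moreover have "a \<bullet> inv L w = a \<bullet> w" for w
    using a_L[of "inv L w"] bij_L by (simp add: surj_f_inv_f bij_is_surj)
  then have "a \<bullet> (inv L ^^ k) w = a \<bullet> w" for k
    by (induction k) simp_all
  ultimately show ?thesis by (simp add: int_funpow_def)
qed

lemma a_f: "a \<bullet> f x = a \<bullet> x + 1"
  by (simp add: f_def inner_add_right a_L a_v)

lemma a_inv_f: "a \<bullet> inv f x = a \<bullet> x - 1"
  using a_f[of "inv f x"] bij_f by (simp add: surj_f_inv_f bij_is_surj)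

lemma a_funpow_f: "a \<bullet> (f ^^ m) x = a \<bullet> x + real m" "a \<bullet> (inv f ^^ m) x = a \<bullet> x - real m"
  by (induction m) (simp_all add: a_f a_inv_f)

lemma a_Y: "a \<bullet> Y m x = 1"
  by (simp add: Y_def a_int_funpow inner_add_right inner_diff_right a_v a_e)

lemma a_X: "a \<bullet> X x = 1"
  by (simp add: X_def Let_def inner_add_right a_Y)

lemma X_nonzero: "X x \<noteq> 0"
  using a_X[of x] by auto

lemma Y_f: "Y (m + 1) (f x) = L (Y m x)"
proof -
  have "s (m + 1) (f x) = s m x"
    by (simp add: s_def int_funpow_commute[OF bij_f])
  then show ?thesis
    by (simp add: Y_def int_funpow_plus_one[OF bij_L])
qed

text \<open>The map raises the time by one, so the fractional part, and with it the interpolation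
  weight, is unchanged while the strip index shifts as in \<open>Y_f\<close>.\<close>

lemma X_f: "X (f x) = L (X x)"
proof -
  have "\<lfloor>a \<bullet> f x\<rfloor> = \<lfloor>a \<bullet> x\<rfloor> + 1" "a \<bullet> f x - real_of_int (\<lfloor>a \<bullet> x\<rfloor> + 1) = a \<bullet> x - \<lfloor>a \<bullet> x\<rfloor>"
    by (simp_all add: a_f)
  moreover have "Y \<lfloor>a \<bullet> x\<rfloor> (f x) = L (Y (\<lfloor>a \<bullet> x\<rfloor> - 1) x)"
    using Y_f[of "\<lfloor>a \<bullet> x\<rfloor> - 1"] by simp
  ultimately show ?thesis
    by (simp add: X_def Let_def a_f Y_f linear_add[OF linear_L] linear_cmul[OF linear_L])
qed

text \<open>Between \<open>m - 1/2\<close> and \<open>m\<close> the weight \<open>\<theta>\<close>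
  is 0 relative to \<open>m\<close> and already 1 relative to \<open>m - 1\<close>, so both sides
  are \<open>Y (m - 1)\<close>. Hence one smooth expression covers a neighbourhood of the place
  where the floor jumps.\<close>

lemma X_local:
  assumes "m - 1/2 < a \<bullet> x" "a \<bullet> x < m + 1"
  shows "X x = \<theta> (a \<bullet> x - real_of_int m) *\<^sub>R Y m x + (1 - \<theta> (a \<bullet> x - m)) *\<^sub>R Y (m - 1) x"
proof (cases "m \<le> a \<bullet> x")
  case True
  then have "\<lfloor>a \<bullet> x\<rfloor> = m" using assms by (simp add: floor_unique)
  then show ?thesis by (simp add: X_def Let_def)
next
  case False
  then have "\<lfloor>a \<bullet> x\<rfloor> = m - 1" using assms by (intro floor_unique) auto
  with False assms show ?thesis by (simp add: X_def Let_def \<theta>_0 \<theta>_1)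
qed

lemma X_eq_Y:
  assumes "m + 1/2 \<le> a \<bullet> x" "a \<bullet> x \<le> m + 1"
  shows "X x = Y m x"
proof (cases "a \<bullet> x = m + 1")
  \<comment> \<open>At the right end the floor is already \<open>m + 1\<close>, but
    \<open>\<theta> 0 = 0\<close> gives all the weight to \<open>Y m\<close>.\<close>
  case True
  then have "\<lfloor>a \<bullet> x\<rfloor> = m + 1" by (intro floor_unique) auto
  with True show ?thesis by (simp add: X_def \<theta>_0)
next
  case False
  with assms show ?thesis using X_local[of m x] by (simp add: \<theta>_1)
qed

lemma bounded_linear_a: "bounded_linear (\<lambda>x. a \<bullet> x)"
  by (rule bounded_linear_inner_right)

lemma tcd_Y: "tcd k (Y m)"
proof -
  have "tcd k (int_funpow (- m) f)"
    by (rule tcd_if_constant_derivative[OF int_funpow_has_derivative[OF f_has_derivative inv_f_has_derivative]])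
  then have "tcd k (s m)"
    unfolding s_def[abs_def] by (rule tcd_linear_compose[OF bounded_linear_inner_right])
  then have "tcd k (\<lambda>x. v - (v \<bullet> e) *\<^sub>R e + (8 * (1 + s m x * s m x)) *\<^sub>R e)"
    by (intro tcd_add[OF tcd_const] tcd_scaleR[OF _ tcd_const] tcd_mult tcd_const)
  then show ?thesis
    unfolding Y_def[abs_def] power2_eq_square
    by (rule tcd_linear_compose[OF linear_int_funpow[unfolded linear_conv_bounded_linear]])
qed

lemma tcd_X: "tcd k X"
proof (rule tcd_local)
  fix x
  define m where "m = \<lfloor>a \<bullet> x\<rfloor>"
  let ?U = "{y. m - 1/2 < a \<bullet> y} \<inter> {y. a \<bullet> y < m + 1}"
  let ?F = "\<lambda>y. \<theta> (a \<bullet> y - real_of_int m) *\<^sub>R Y m y + (1 - \<theta> (a \<bullet> y - m)) *\<^sub>R Y (m - 1) y"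
  have "open ?U"
    by (intro open_Int open_halfspace_gt open_halfspace_lt)
  moreover have "x \<in> ?U"
    unfolding m_def by (simp, linarith)
  moreover have "tcd k (\<lambda>y. \<theta> (a \<bullet> y - real_of_int m))"
    by (rule tcd_real_compose[OF \<theta>_smooth tcd_diff[OF tcd_bounded_linear[OF bounded_linear_a] tcd_const]])
  then have "tcd k ?F"
    by (rule_tac tcd_add[OF tcd_scaleR[OF _ tcd_Y] tcd_scaleR[OF tcd_diff[OF tcd_const] tcd_Y]])
  ultimately show "\<exists>U F. open U \<and> x \<in> U \<and> tcd k F \<and> (\<forall>y\<in>U. X y = F y)"
    using X_local by (intro exI[of _ ?U] exI[of _ ?F]) auto
qed

section \<open>The adapted metric\<close>

text \<open>Over one unit of time the weights change by the factor \<open>exp c = 2 * K\<close>,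
  which beats the growth bound \<open>K\<close> and leaves a contraction by 1/2.\<close>

definition c :: real where "c = ln (2 * K)"

lemma c_pos: "0 < c" and exp_c: "exp c = 2 * K"
  using K(1) by (simp_all add: c_def ln_gt_zero)

lemma exp_minus_c_mult_le: "exp (- (c * real m)) * K ^ m \<le> (1/2) ^ m"
proof -
  have "exp (- (c * real m)) = (inverse (2 * K)) ^ m"
    by (metis exp_c exp_minus exp_of_nat2_mult mult.commute power_inverse)
  then have "exp (- (c * real m)) * K ^ m = (inverse (2 * K) * K) ^ m"
    by (simp only: power_mult_distrib)
  also have "inverse (2 * K) * K = 1/2"
    using K(1) by (simp add: field_simps)
  finally show ?thesis by simp
qed

text \<open>Since \<open>a \<bullet> X x = 1\<close>, this and \<open>stab\<close> are the
  projections onto the line of \<open>X x\<close> and the kernel of a.\<close>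

definition unst :: "'a \<Rightarrow> 'a \<Rightarrow> 'a" where "unst x w = (a \<bullet> w) *\<^sub>R X x"

definition stab :: "'a \<Rightarrow> 'a \<Rightarrow> 'a" where "stab x w = w - unst x w"

definition g :: "'a \<Rightarrow> 'a \<Rightarrow> 'a \<Rightarrow> real" where
  "g x u w = exp (- (2 * c * (a \<bullet> x))) * (stab x u \<bullet> stab x w) + exp (2 * c * (a \<bullet> x)) * (unst x u \<bullet> unst x w)"

lemma g_metric: "riemannian_metric g"
  unfolding riemannian_metric_def
proof (intro conjI allI impI)
  show "bilinear (g x)" for x
    unfolding bilinear_def
    by (auto intro!: linearI simp: g_def stab_def unst_def inner_simps algebra_simps)
  show "g x u w = g x w u" for x u w
    by (simp add: g_def inner_commute)
  show "g x u u > 0" if "u \<noteq> 0" for x u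
  proof -
    have "stab x u \<noteq> 0 \<or> unst x u \<noteq> 0"
      using that by (auto simp: stab_def)
    then have "stab x u \<bullet> stab x u > 0 \<or> unst x u \<bullet> unst x u > 0"
      by simp
    then show ?thesis
      unfolding g_def by (auto intro: add_pos_nonneg add_nonneg_pos)
  qed
  show "smooth (\<lambda>x. g x u w)" for u w
    unfolding smooth_def
  proof
    fix k
    have unst: "tcd k (\<lambda>x. unst x w)" for w
      unfolding unst_def by (rule tcd_scaleR[OF tcd_const tcd_X])
    have stab: "tcd k (\<lambda>x. stab x w)" for w
      unfolding stab_def by (rule tcd_diff[OF tcd_const unst])
    have "tcd k (\<lambda>x. r * (a \<bullet> x))" for r
      by (rule tcd_mult[OF tcd_const tcd_bounded_linear[OF bounded_linear_a]])
    then have ex: "tcd k (\<lambda>x. exp (r * (a \<bullet> x)))" for r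
      by (rule tcd_real_compose[OF tcd_exp])
    show "tcd k (\<lambda>x. g x u w)"
      unfolding g_def using ex[of "- (2 * c)"] ex[of "2 * c"]
      by (rule_tac tcd_add[OF tcd_mult[OF _ tcd_inner[OF stab stab]] tcd_mult[OF _ tcd_inner[OF unst unst]]]) simp_all
  qed
qed

abbreviation N :: "'a \<Rightarrow> 'a \<Rightarrow> real" where "N \<equiv> riemannian_norm g"

lemma N_stable: "stab x w = w \<Longrightarrow> N x w = exp (- (c * (a \<bullet> x))) * norm w"
  and N_unstable: "unst x w = w \<Longrightarrow> N x w = exp (c * (a \<bullet> x)) * norm w"
proof -
  have sq: "exp (2 * r) = (exp r)\<^sup>2" for r :: real
    by (simp add: exp_double)
  show "N x w = exp (- (c * (a \<bullet> x))) * norm w" if "stab x w = w"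
    using that sq[of "- (c * (a \<bullet> x))"]
    by (simp add: riemannian_norm_def g_def stab_def real_sqrt_mult norm_eq_sqrt_inner mult.assoc)
  show "N x w = exp (c * (a \<bullet> x)) * norm w" if "unst x w = w"
    using that sq[of "c * (a \<bullet> x)"]
    by (simp add: riemannian_norm_def g_def stab_def real_sqrt_mult norm_eq_sqrt_inner mult.assoc)
qed

lemma norm_stab_le: "norm (stab x w) \<le> exp (c * (a \<bullet> x)) * N x w"
  and norm_unst_le: "norm (unst x w) \<le> exp (- (c * (a \<bullet> x))) * N x w"
proof -
  let ?t = "c * (a \<bullet> x)"
  have g: "g x w w = (exp (- ?t) * norm (stab x w))\<^sup>2 + (exp ?t * norm (unst x w))\<^sup>2"
    by (simp add: g_def power_mult_distrib power2_norm_eq_inner exp_double[symmetric] mult.assoc)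
  have "exp (- ?t) * norm (stab x w) \<le> N x w" "exp ?t * norm (unst x w) \<le> N x w"
    unfolding riemannian_norm_def g by (auto intro!: real_le_rsqrt)
  then have "exp ?t * (exp (- ?t) * norm (stab x w)) \<le> exp ?t * N x w"
    "exp (- ?t) * (exp ?t * norm (unst x w)) \<le> exp (- ?t) * N x w"
    by (simp_all add: mult_left_mono)
  then show "norm (stab x w) \<le> exp ?t * N x w" "norm (unst x w) \<le> exp (- ?t) * N x w"
    by (simp_all add: mult.assoc[symmetric] exp_add[symmetric])
qed

lemma a_inner_le: "\<bar>a \<bullet> w\<bar> \<le> norm a * exp (- (c * (a \<bullet> x))) * N x w"
proof -
  have "a \<bullet> unst x w = a \<bullet> w"
    by (simp add: unst_def a_X)
  then have "\<bar>a \<bullet> w\<bar> \<le> norm a * norm (unst x w)"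
    by (metis Cauchy_Schwarz_ineq2)
  also have "\<dots> \<le> norm a * (exp (- (c * (a \<bullet> x))) * N x w)"
    by (intro mult_left_mono norm_unst_le) simp
  finally show ?thesis by (simp add: mult.assoc)
qed

lemma norm_le_N:
  assumes "\<bar>a \<bullet> x\<bar> \<le> T"
  shows "norm w \<le> 2 * exp (c * T) * N x w"
proof -
  have "norm w \<le> norm (stab x w) + norm (unst x w)"
    using norm_triangle_ineq[of "stab x w" "unst x w"] by (simp add: stab_def)
  also have "\<dots> \<le> exp (c * (a \<bullet> x)) * N x w + exp (- (c * (a \<bullet> x))) * N x w"
    by (intro add_mono norm_stab_le norm_unst_le)
  also have "\<dots> \<le> exp (c * T) * N x w + exp (c * T) * N x w"
  proof -
    have "c * (a \<bullet> x) \<le> c * T" "c * (- (a \<bullet> x)) \<le> c * T"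
      using assms c_pos by (intro mult_left_mono; linarith)+
    then show ?thesis
      using riemannian_norm_nonneg[OF g_metric] by (intro add_mono mult_right_mono) auto
  qed
  finally show ?thesis by simp
qed

section \<open>Time along short paths, and completeness\<close>

text \<open>Only the unstable component changes the time, and its weight is the exponential in
  question. So this exponential of time has a differential bounded by \<open>c * norm a\<close> in
  the metric.\<close>

lemma time_upper_bound:
  assumes "valid_path \<gamma>" "has_riemannian_length g \<gamma> l" "l \<le> 1" "b \<in> {0..1}"
  shows "exp (c * (a \<bullet> \<gamma> b)) \<le> exp (c * (a \<bullet> \<gamma> 0)) + c * norm a"
proof -
  have "norm (exp (c * (a \<bullet> \<gamma> b)) - exp (c * (a \<bullet> \<gamma> 0))) \<le> c * norm a * l"
  proof (rule norm_diff_le_riemannian_length[OF g_metric assms(1,2), where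
        H = "\<lambda>x. exp (c * (a \<bullet> x))" and H' = "\<lambda>x w. c * (a \<bullet> w) * exp (c * (a \<bullet> x))"])
    show "((\<lambda>x. exp (c * (a \<bullet> x))) has_derivative (\<lambda>w. c * (a \<bullet> w) * exp (c * (a \<bullet> \<gamma> t)))) (at (\<gamma> t))" for t
      by (auto intro!: derivative_eq_intros)
    show "norm (c * (a \<bullet> w) * exp (c * (a \<bullet> \<gamma> t))) \<le> c * norm a * N (\<gamma> t) w" for t w
    proof -
      have "norm (c * (a \<bullet> w) * exp (c * (a \<bullet> \<gamma> t))) = c * exp (c * (a \<bullet> \<gamma> t)) * \<bar>a \<bullet> w\<bar>"
        using c_pos by (simp add: abs_mult)
      also have "\<dots> \<le> c * exp (c * (a \<bullet> \<gamma> t)) * (norm a * exp (- (c * (a \<bullet> \<gamma> t))) * N (\<gamma> t) w)"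
        using c_pos by (intro mult_left_mono a_inner_le) auto
      also have "\<dots> = c * norm a * N (\<gamma> t) w"
        by (simp add: exp_minus field_simps)
      finally show ?thesis .
    qed
  qed (use assms c_pos in auto)
  also have "\<dots> \<le> c * norm a * 1"
    using assms(3) c_pos by (intro mult_left_mono) auto
  finally show ?thesis by simp
qed

text \<open>
  On the strip where \<open>X = Y m\<close>, the differential of \<open>a \<bullet> x - arctan (s m x) / 8\<close> kills \<open>X\<close>.
  Hence only the stable component moves this function, and that is expensive for \<open>m \<rightarrow> -\<infinity>\<close>.
\<close>

definition H :: "int \<Rightarrow> 'a \<Rightarrow> real" where "H m x = a \<bullet> x - arctan (s m x) / 8"

lemma s_has_derivative: "(s m has_derivative (\<lambda>w. e \<bullet> int_funpow (- m) L w)) (at x)"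
  unfolding s_def[abs_def]
  by (intro has_derivative_inner_right int_funpow_has_derivative f_has_derivative inv_f_has_derivative)

lemma H_has_derivative:
  "(H m has_derivative (\<lambda>w. a \<bullet> w - e \<bullet> int_funpow (- m) L w / (8 * (1 + (s m x)\<^sup>2)))) (at x)"
proof -
  have "(arctan has_derivative (\<lambda>r. inverse (1 + (s m x)\<^sup>2) * r)) (at (s m x))"
    using DERIV_arctan[of "s m x"] by (simp add: has_field_derivative_def)
  from bounded_linear.has_derivative[OF bounded_linear_divide has_derivative_compose[OF s_has_derivative this], of 8]
  have "(H m has_derivative (\<lambda>w. a \<bullet> w - (inverse (1 + (s m x)\<^sup>2) * (e \<bullet> int_funpow (- m) L w)) / 8)) (at x)"
    unfolding H_def[abs_def] by (intro derivative_intros)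
  moreover have "inverse d * r / 8 = r / (8 * d)" for d r :: real
    by (cases "d = 0") (auto simp: field_simps)
  ultimately show ?thesis by (simp only:)
qed

lemma int_funpow_minus_self: "int_funpow (- m) L (int_funpow m L w) = w"
proof (induction m arbitrary: w rule: int_induct[where k = 0])
  case base
  show ?case by (simp add: int_funpow_def)
next
  case (step1 i)
  have "int_funpow (- (i + 1)) L (int_funpow (i + 1) L w) = int_funpow (- (i + 1) + 1) L (int_funpow i L w)"
    by (simp only: int_funpow_plus_one[OF bij_L, of i] int_funpow_commute[OF bij_L])
  with step1 show ?case by simp
next
  case (step2 i)
  have "int_funpow (- (i - 1)) L (int_funpow (i - 1) L w) = int_funpow (- i) L (L (int_funpow (i - 1) L w))"
    by (simp only: int_funpow_commute[OF bij_L]) simp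
  also have "L (int_funpow (i - 1) L w) = int_funpow i L w"
    using int_funpow_plus_one[OF bij_L, of "i - 1"] by simp
  finally show ?case by (simp add: step2)
qed

lemma H_derivative_on_strip:
  assumes "m + 1/2 \<le> a \<bullet> x" "a \<bullet> x \<le> m + 1"
  shows "a \<bullet> w - e \<bullet> int_funpow (- m) L w / (8 * (1 + (s m x)\<^sup>2)) =
    - (e \<bullet> int_funpow (- m) L (stab x w) / (8 * (1 + (s m x)\<^sup>2)))"
proof -
  have "e \<bullet> int_funpow (- m) L (Y m x) = 8 * (1 + (s m x)\<^sup>2)"
    using norm_e by (simp add: Y_def int_funpow_minus_self inner_simps inner_commute norm_eq_1)
  moreover have "w = stab x w + (a \<bullet> w) *\<^sub>R Y m x"
    by (simp add: stab_def unst_def X_eq_Y[OF assms])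
  then have "int_funpow (- m) L w = int_funpow (- m) L (stab x w) + (a \<bullet> w) *\<^sub>R int_funpow (- m) L (Y m x)"
    by (metis linear_add linear_cmul linear_int_funpow)
  moreover have "1 + (s m x)\<^sup>2 > 0"
    by (simp add: add_pos_nonneg)
  ultimately show ?thesis
    by (simp add: inner_add_right add_divide_distrib)
qed

lemma norm_funpow_L_le: "norm ((L ^^ k) w) \<le> K ^ k * norm w" "norm ((inv L ^^ k) w) \<le> K ^ k * norm w"
proof -
  have *: "norm ((T ^^ k) w) \<le> K ^ k * norm w" if "\<And>x. norm (T x) \<le> K * norm x" for T :: "'a \<Rightarrow> 'a"
  proof (induction k)
    case (Suc k)
    have "norm ((T ^^ Suc k) w) \<le> K * norm ((T ^^ k) w)"
      using that by simp
    also have "\<dots> \<le> K * (K ^ k * norm w)"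
      using K(1) Suc by (intro mult_left_mono) auto
    finally show ?case by (simp add: mult.assoc)
  qed simp
  show "norm ((L ^^ k) w) \<le> K ^ k * norm w" "norm ((inv L ^^ k) w) \<le> K ^ k * norm w"
    using *[OF K(2)] *[OF K(3)] by auto
qed

text \<open>Transport by \<open>L ^^ k\<close> costs \<open>K ^ k\<close>, while the Euclidean
  length of the stable part is at most \<open>exp (c * (- real k + 1))\<close> times the Riemannian
  norm. Since \<open>exp c = 2 * K\<close>, the product decays like
  \<open>(1/2) ^ k\<close>.\<close>

lemma H_derivative_le:
  assumes x: "- real k + 1/2 \<le> a \<bullet> x" "a \<bullet> x \<le> - real k + 1"
  shows "\<bar>a \<bullet> w - e \<bullet> int_funpow (int k) L w / (8 * (1 + (s (- int k) x)\<^sup>2))\<bar> \<le> exp c * (1/2) ^ k * N x w"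
proof -
  let ?d = "8 * (1 + (s (- int k) x)\<^sup>2)"
  have d: "1 \<le> ?d"
    using mult_mono[of 1 8 1 "1 + (s (- int k) x)\<^sup>2"] by simp
  have "\<bar>a \<bullet> w - e \<bullet> int_funpow (int k) L w / ?d\<bar> = \<bar>e \<bullet> int_funpow (int k) L (stab x w)\<bar> / ?d"
    using H_derivative_on_strip[of "- int k" x w] x d by (simp add: abs_divide)
  also have "\<dots> \<le> \<bar>e \<bullet> int_funpow (int k) L (stab x w)\<bar>"
    using frac_le[OF abs_ge_zero order_refl zero_less_one d] by simp
  also have "\<dots> \<le> norm ((L ^^ k) (stab x w))"
    using Cauchy_Schwarz_ineq2[of e "(L ^^ k) (stab x w)"] norm_e by (simp add: int_funpow_def)
  also have "\<dots> \<le> K ^ k * norm (stab x w)"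
    by (rule norm_funpow_L_le)
  also have "\<dots> \<le> K ^ k * (exp (c * (a \<bullet> x)) * N x w)"
    using K(1) by (intro mult_left_mono norm_stab_le) auto
  also have "\<dots> \<le> K ^ k * (exp (c * (- real k + 1)) * N x w)"
    using K(1) c_pos x riemannian_norm_nonneg[OF g_metric]
    by (intro mult_left_mono mult_right_mono) auto
  also have "\<dots> = exp c * (exp (- (c * real k)) * K ^ k) * N x w"
    by (simp add: exp_add[symmetric] algebra_simps)
  also have "\<dots> \<le> exp c * (1/2) ^ k * N x w"
    using riemannian_norm_nonneg[OF g_metric]
    by (intro mult_left_mono mult_right_mono exp_minus_c_mult_le) auto
  finally show ?thesis .
qed

text \<open>Descending through the strip changes the time by 1/2, of which the arctangent can
  compensate at most (1.6 + 1.6) / 8 = 0.4, as pi / 2 < 1.6. So \<open>H\<close> would change by at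
  least 0.1, whereas the length allows at most 1/20.\<close>

lemma time_lower_bound:
  assumes \<gamma>: "valid_path \<gamma>" "has_riemannian_length g \<gamma> l" "l \<le> 1" "b \<in> {0..1}"
    and k: "- real k + 1 \<le> a \<bullet> \<gamma> 0" "exp c * (1/2) ^ k < 1/20"
  shows "- real k + 1/2 \<le> a \<bullet> \<gamma> b"
proof (rule ccontr)
  assume "\<not> - real k + 1/2 \<le> a \<bullet> \<gamma> b"
  then have b: "a \<bullet> \<gamma> b \<le> - real k + 1/2" by simp
  have "continuous_on {0..b} (\<lambda>t. a \<bullet> \<gamma> t)"
    by (rule continuous_on_inner[OF continuous_on_const], rule continuous_on_subset[of "{0..1}"])
      (use \<gamma>(1,4) in \<open>auto simp: valid_path_def piecewise_C1_differentiable_on_def\<close>)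
  then obtain r t where rt: "0 \<le> r" "r \<le> t" "t \<le> b" "a \<bullet> \<gamma> r = - real k + 1" "a \<bullet> \<gamma> t = - real k + 1/2"
    "\<And>u. u \<in> {r..t} \<Longrightarrow> - real k + 1/2 \<le> a \<bullet> \<gamma> u \<and> a \<bullet> \<gamma> u \<le> - real k + 1"
    using crossing_interval[of b "\<lambda>t. a \<bullet> \<gamma> t" "- real k + 1" "- real k + 1/2"] b k \<gamma>(4) by auto
  have "norm (H (- int k) (\<gamma> t) - H (- int k) (\<gamma> r)) \<le> exp c * (1/2) ^ k * l"
    using H_has_derivative[of "- int k"] H_derivative_le rt \<gamma>(4)
    by (intro norm_diff_le_riemannian_length[OF g_metric \<gamma>(1,2), where H = "H (- int k)" and
          H' = "\<lambda>x w. a \<bullet> w - e \<bullet> int_funpow (int k) L w / (8 * (1 + (s (- int k) x)\<^sup>2))"]) auto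
  also have "\<dots> \<le> 1/20"
    using k(2) \<gamma>(3) riemannian_length_nonneg[OF g_metric \<gamma>(2)]
    by (smt (verit) mult_left_le exp_gt_zero zero_less_power zero_less_mult_iff divide_pos_pos)
  finally have "\<bar>H (- int k) (\<gamma> t) - H (- int k) (\<gamma> r)\<bar> \<le> 1/20" by simp
  moreover have "\<bar>arctan y\<bar> \<le> pi / 2" for y
    using arctan_bounded[of y] by linarith
  then have "\<bar>arctan y\<bar> \<le> 1.6" for y
    by (rule order.trans) (use pi_approx in simp)
  from this[of "s (- int k) (\<gamma> t)"] this[of "s (- int k) (\<gamma> r)"]
  have "\<bar>arctan (s (- int k) (\<gamma> t))\<bar> \<le> 1.6" "\<bar>arctan (s (- int k) (\<gamma> r))\<bar> \<le> 1.6" .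
  ultimately show False
    using rt(4,5) by (simp add: H_def abs_le_iff)
qed

text \<open>The two time bounds confine a path of length at most one, started in a given ball, to a
  slab of bounded time, where \<open>norm_le_N\<close> compares the norms.\<close>

lemma g_complete: "complete_riemannian_metric g"
proof (rule complete_riemannian_metricI[OF g_metric])
  fix R :: real
  have "(\<lambda>k. exp c * (1/2) ^ k) \<longlonglongrightarrow> exp c * 0"
    by (intro tendsto_intros LIMSEQ_power_zero) simp
  then have "\<forall>\<^sub>F k in sequentially. exp c * (1/2) ^ k < 1/20"
    by (rule order_tendstoD(2)) simp
  moreover have "\<forall>\<^sub>F k in sequentially. norm a * R + 1 \<le> real k"
    using filterlim_real_sequentially by (simp add: filterlim_at_top)
  ultimately have "\<forall>\<^sub>F k in sequentially. exp c * (1/2) ^ k < 1/20 \<and> norm a * R + 1 \<le> real k"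
    by (rule eventually_conj)
  \<comment> \<open>The second condition places the whole ball of radius \<open>R\<close> above the
    strip with index \<open>- k\<close>, as \<open>time_lower_bound\<close> requires of the starting
    point.\<close>
  then obtain k where k: "exp c * (1/2) ^ k < 1/20" "norm a * R + 1 \<le> real k"
    using eventually_happens'[OF sequentially_bot] by blast
  define E where "E = exp (c * (norm a * R)) + c * norm a"
  define T where "T = max (real k) (ln E / c)"
  have bound: "norm (\<gamma> 1 - \<gamma> 0) \<le> 2 * exp (c * T) * l"
    if \<gamma>: "valid_path \<gamma>" "has_riemannian_length g \<gamma> l" "norm (\<gamma> 0) \<le> R" "l \<le> 1" for \<gamma> l
  proof (rule norm_diff_le_riemannian_length[OF g_metric \<gamma>(1,2), where H = "\<lambda>x. x" and H' = "\<lambda>_ w. w"])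
    fix t w assume t: "t \<in> {0..1::real}"
    have "\<bar>a \<bullet> \<gamma> 0\<bar> \<le> norm a * norm (\<gamma> 0)"
      by (rule Cauchy_Schwarz_ineq2)
    also have "\<dots> \<le> norm a * R"
      using \<gamma>(3) by (intro mult_left_mono) auto
    finally have 0: "\<bar>a \<bullet> \<gamma> 0\<bar> \<le> norm a * R" .
    have "exp (c * (a \<bullet> \<gamma> t)) \<le> exp (c * (a \<bullet> \<gamma> 0)) + c * norm a"
      by (rule time_upper_bound[OF \<gamma>(1,2,4) t])
    also have "\<dots> \<le> E"
      using 0 c_pos by (simp add: E_def mult_left_mono)
    finally have "c * (a \<bullet> \<gamma> t) \<le> ln E"
      by (metis exp_gt_zero ln_exp ln_mono order_less_le_trans)
    then have "a \<bullet> \<gamma> t \<le> ln E / c"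
      using c_pos by (simp add: field_simps)
    moreover have "- real k + 1/2 \<le> a \<bullet> \<gamma> t"
      using k 0 by (intro time_lower_bound[OF \<gamma>(1,2,4) t]) auto
    ultimately have "\<bar>a \<bullet> \<gamma> t\<bar> \<le> T"
      by (auto simp: T_def abs_le_iff)
    then show "norm w \<le> 2 * exp (c * T) * N (\<gamma> t) w"
      by (rule norm_le_N)
  qed (auto intro: has_derivative_ident)
  then show "\<exists>\<kappa>. \<forall>\<gamma> l. valid_path \<gamma> \<longrightarrow> has_riemannian_length g \<gamma> l \<longrightarrow> norm (pathstart \<gamma>) \<le> R \<longrightarrow>
      l \<le> 1 \<longrightarrow> norm (pathfinish \<gamma> - pathstart \<gamma>) \<le> \<kappa> * l"
    unfolding pathstart_def pathfinish_def by blast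
qed

section \<open>Contraction estimates and the invariant splitting\<close>

definition Es :: "'a set" where "Es = {w. a \<bullet> w = 0}"

lemma subspace_Es: "subspace Es"
  unfolding Es_def by (rule subspace_hyperplane)

text \<open>After \<open>m\<close> steps the time has grown by \<open>m\<close>, so the stable
  weight has dropped by the factor \<open>exp (- (c * real m))\<close>, while the vector has grown
  at most by \<open>K ^ m\<close>.\<close>

lemma stable_contraction:
  assumes "w \<in> Es"
  shows "N ((f ^^ m) x) ((L ^^ m) w) \<le> (1/2) ^ m * N x w"
proof -
  have "a \<bullet> (L ^^ m) w = a \<bullet> w"
    using a_int_funpow[of "int m" w] by (simp add: int_funpow_def)
  then have st: "stab y w = w" "stab y ((L ^^ m) w) = (L ^^ m) w" for y
    using assms by (simp_all add: stab_def unst_def Es_def)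
  have "N ((f ^^ m) x) ((L ^^ m) w) = exp (- (c * (a \<bullet> x + real m))) * norm ((L ^^ m) w)"
    by (simp add: N_stable[OF st(2)] a_funpow_f)
  also have "\<dots> \<le> exp (- (c * (a \<bullet> x + real m))) * (K ^ m * norm w)"
    by (intro mult_left_mono norm_funpow_L_le) auto
  also have "\<dots> = (exp (- (c * real m)) * K ^ m) * (exp (- (c * (a \<bullet> x))) * norm w)"
    by (simp add: exp_add[symmetric] distrib_left)
  also have "\<dots> \<le> (1/2) ^ m * (exp (- (c * (a \<bullet> x))) * norm w)"
    by (intro mult_right_mono exp_minus_c_mult_le) auto
  finally show ?thesis by (simp add: N_stable[OF st(1)])
qed

text \<open>Invariance keeps the backward iterates on the line of \<open>X\<close>, so only the
  unstable weight occurs, and going back in time lowers it.\<close>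

lemma unstable_contraction:
  assumes "w \<in> span {X x}"
  shows "N ((inv f ^^ m) x) ((inv L ^^ m) w) \<le> (1/2) ^ m * N x w"
proof -
  obtain r where w: "w = r *\<^sub>R X x"
    using assms by (auto simp: span_singleton)
  have "(inv L ^^ m) w = r *\<^sub>R X ((inv f ^^ m) x)"
  proof (induction m)
    case (Suc m)
    have "X ((inv f ^^ m) x) = L (X ((inv f ^^ Suc m) x))"
      using X_f[of "(inv f ^^ Suc m) x"] bij_f by (simp add: surj_f_inv_f bij_is_surj)
    with Suc show ?case
      using bij_L by (simp add: linear_cmul[OF linear_inv_L] bij_is_inj)
  qed (simp add: w)
  then have un: "unst x w = w" "unst ((inv f ^^ m) x) ((inv L ^^ m) w) = (inv L ^^ m) w"
    by (simp_all add: unst_def a_X w)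
  have "N ((inv f ^^ m) x) ((inv L ^^ m) w) = exp (c * (a \<bullet> x - real m)) * norm ((inv L ^^ m) w)"
    by (simp add: N_unstable[OF un(2)] a_funpow_f)
  also have "\<dots> \<le> exp (c * (a \<bullet> x - real m)) * (K ^ m * norm w)"
    by (intro mult_left_mono norm_funpow_L_le) auto
  also have "\<dots> = (exp (- (c * real m)) * K ^ m) * (exp (c * (a \<bullet> x)) * norm w)"
    by (simp add: exp_add[symmetric] right_diff_distrib)
  also have "\<dots> \<le> (1/2) ^ m * (exp (c * (a \<bullet> x)) * norm w)"
    by (intro mult_right_mono exp_minus_c_mult_le) auto
  finally show ?thesis by (simp add: N_unstable[OF un(1)])
qed

lemma splitting: "continuous_splitting (\<lambda>_. Es) (\<lambda>x. span {X x})"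
  unfolding continuous_splitting_def
proof (intro conjI allI)
  show "continuous_subbundle (\<lambda>_. Es)"
    by (rule continuous_subbundle_const[OF subspace_Es])
  have "lessThan (1::nat) = {0}" by auto
  then show "continuous_subbundle (\<lambda>x. span {X x})"
    unfolding continuous_subbundle_def using tcd_continuous_on[OF tcd_X] X_nonzero
    by (intro allI exI[of _ UNIV] exI[of _ 1] exI[of _ "\<lambda>_. X"]) auto
  fix x
  show "Es \<inter> span {X x} = {0}"
    by (auto simp: Es_def span_singleton a_X)
  have "\<exists>y z. w = y + z \<and> y \<in> Es \<and> z \<in> span {X x}" for w
    by (intro exI[of _ "stab x w"] exI[of _ "unst x w"])
      (auto simp: stab_def unst_def Es_def span_singleton inner_diff_right a_X)
  then show "{y + z | y z. y \<in> Es \<and> z \<in> span {X x}} = UNIV"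
    by auto
qed

lemma anosov_f: "anosov g f"
proof -
  have "L ` Es = Es"
    by (rule linear_inj_image_subspace_eq[OF linear_L _ subspace_Es])
      (auto simp: Es_def a_L intro: inj_on_subset[OF bij_is_inj[OF bij_L]])
  then have "derivative_invariant f (\<lambda>_. Es)"
    by (simp add: derivative_invariant_def f_def affine_frechet_derivatives[OF linear_L bij_L])
  moreover have "derivative_invariant f (\<lambda>x. span {X x})"
    using X_f by (simp add: derivative_invariant_def f_def affine_frechet_derivatives[OF linear_L bij_L]
        linear_span_image[OF linear_L, symmetric])
  moreover have "diffeomorphism f"
    unfolding f_def by (rule diffeomorphism_affine[OF linear_L bij_L])
  moreover have "frechet_derivative (f ^^ m) (at x) = L ^^ m" "frechet_derivative (inv f ^^ m) (at x) = inv L ^^ m" for m x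
    unfolding f_def by (rule affine_frechet_derivatives[OF linear_L bij_L])+
  ultimately show ?thesis
    unfolding anosov_def using splitting stable_contraction unstable_contraction
    by (intro conjI exI[of _ "\<lambda>_. Es"] exI[of _ "\<lambda>x. span {X x}"] exI[of _ 1] exI[of _ "1/2"]) auto
qed

end

section \<open>From a missing fixed point to the covector of time\<close>

lemma fixed_point_free_imp_anosov:
  fixes A :: "real ^ 'n ^ 'n"
  assumes "CARD('n) \<ge> 2" "invertible A" and v: "v \<notin> range (\<lambda>x. (mat 1 - A) *v x)"
  shows "\<exists>g. complete_riemannian_metric g \<and> anosov g (affine_map A v)"
proof -
  let ?S = "range (\<lambda>x. (mat 1 - A) *v x)"
  obtain \<theta> :: "real \<Rightarrow> real" where \<theta>: "\<And>k. tcd k \<theta>" "\<And>t. t \<le> 0 \<Longrightarrow> \<theta> t = 0" "\<And>t. t \<ge> 1/2 \<Longrightarrow> \<theta> t = 1"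
    using ex_smooth_step by blast
  have span: "span ?S = ?S"
    unfolding span_eq_iff by (intro linear_subspace_image subspace_UNIV) simp
  obtain y z where yz: "y \<in> ?S" "\<And>w. w \<in> ?S \<Longrightarrow> orthogonal z w" "v = y + z"
    using orthogonal_subspace_decomp_exists[of ?S v] unfolding span by metis
  have "z \<noteq> 0" using yz v by auto
  \<comment> \<open>\<open>z\<close> is the part of \<open>v\<close> orthogonal to the image of I -
    A. Dividing by its squared length gives \<open>a \<bullet> v = 1\<close>, and orthogonality
    gives \<open>a \<bullet> (A *v x) = a \<bullet> x\<close>.\<close>
  define a where "a = z /\<^sub>R (z \<bullet> z)"
  have "z \<bullet> y = 0"
    using yz(1,2) by (simp add: orthogonal_def)
  then have a_v: "a \<bullet> v = 1"
    using \<open>z \<noteq> 0\<close> by (simp add: a_def yz(3) inner_add_right)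
  have "a \<bullet> ((mat 1 - A) *v x) = 0" for x
    using yz(2)[of "(mat 1 - A) *v x"] by (simp add: a_def orthogonal_def)
  then have a_A: "a \<bullet> (A *v x) = a \<bullet> x" for x
    by (simp add: matrix_vector_mult_diff_rdistrib inner_diff_right)
  \<comment> \<open>The dimension hypothesis enters here: it provides the direction in the kernel of
    a along which integral curves escape.\<close>
  obtain e' where e': "e' \<noteq> 0" "orthogonal a e'"
    using orthogonal_to_vector_exists[of a] assms(1) by auto
  have lin: "linear ((*v) A)" and bij: "bij ((*v) A)"
    using bij_matrix_vector_mult[OF assms(2)] by simp_all
  have "linear (inv ((*v) A))"
    using lin bij by (simp add: inj_linear_imp_inv_linear bij_is_inj)
  then obtain K1 K2 where K: "\<And>x. norm (A *v x) \<le> norm x * K1" "\<And>x. norm (inv ((*v) A) x) \<le> norm x * K2"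
    using lin bounded_linear.bounded unfolding linear_conv_bounded_linear by metis
  interpret fixed_point_free "(*v) A" v a "e' /\<^sub>R norm e'" \<theta> "max 1 (max K1 K2)"
  proof (rule fixed_point_free.intro)
    show "norm (A *v x) \<le> max 1 (max K1 K2) * norm x" for x
      using order.trans[OF K(1) mult_left_mono[of K1 "max 1 (max K1 K2)"]] by (simp add: mult.commute le_max_iff_disj)
    show "norm (inv ((*v) A) x) \<le> max 1 (max K1 K2) * norm x" for x
      using order.trans[OF K(2) mult_left_mono[of K2 "max 1 (max K1 K2)"]] by (simp add: mult.commute le_max_iff_disj)
  qed (use lin bij a_A a_v e' \<theta> in \<open>simp_all add: orthogonal_def\<close>)
  have "f = affine_map A v"
    by (simp add: f_def affine_map_def[abs_def])
  then show ?thesis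
    using g_complete anosov_f by auto
qed

theorem theorem1p1:
  fixes A :: "real ^ 'n ^ 'n" and v :: "real ^ 'n"
  assumes "CARD('n) \<ge> 2" and "invertible A"
  shows "((\<exists>g. complete_riemannian_metric g \<and> anosov g (affine_map A v)) \<longleftrightarrow>
            hyperbolic_matrix A \<or> \<not> (\<exists>x. affine_map A v x = x)) \<and>
         (\<not> (\<exists>x. affine_map A v x = x) \<longleftrightarrow> v \<notin> range (\<lambda>x. (mat 1 - A) *v x))"
proof -
  have "affine_map A v x = x \<longleftrightarrow> v = (mat 1 - A) *v x" for x
    by (auto simp: affine_map_def matrix_vector_mult_diff_rdistrib algebra_simps)
  then have fixed: "\<not> (\<exists>x. affine_map A v x = x) \<longleftrightarrow> v \<notin> range (\<lambda>x. (mat 1 - A) *v x)"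
    by auto
  moreover have "hyperbolic_matrix A"
    if "complete_riemannian_metric g" "anosov g (affine_map A v)" "affine_map A v x = x" for g x
    using anosov_fixed_point_imp_hyperbolic[OF assms(2) _ that(2,3)] that(1)
    by (simp add: complete_riemannian_metric_def)
  moreover have "\<exists>g. complete_riemannian_metric g \<and> anosov g (affine_map A v)" if "hyperbolic_matrix A"
    using complete_euclidean_metric hyperbolic_imp_anosov_euclidean[OF assms(2) that] by blast
  ultimately show ?thesis
    using fixed_point_free_imp_anosov[OF assms] by metis
qed

end
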